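(* Let $d\ge 1$, let $W$ be a finite dimensional complex Hilbert space, and let $U$ be a periodic unitary transition operator on $H=\ell^{2}(\mathbb{Z}^{d},W)$. Suppose that $U$ has only one eigenvalue $\omega$, and let $\pi$ be the orthogonal projection onto the eigenspace corresponding to the eigenvalue $\omega$. Then, for any $u\in H$ and $x\in\mathbb{Z}^{d}$, the limit $\lim_{n\to\infty}p_{n}(u;x)$ exists and $$\lim_{n\to\infty}p_{n}(u;x)=\|(\pi u)(x)\|_{W}^{2}.$$
   Context: $\ell^{2}(\mathbb{Z}^{d},W)$ is the Hilbert space of square summable $W$-valued functions on $\mathbb{Z}^d$ with inner product $\langle f,g\rangle=\sum_{x}\langle f(x),g(x)\rangle_{W}$. For $y\in\mathbb{Z}^{d}$ and $\phi\in W$, $\delta_{y}\otimes\phi$ is the function with value $\phi$ at $y$ and $0$ elsewhere. A unitary operator $U$ on $\ell^{2}(\mathbb{Z}^{d},W)$ is a periodic unitary transition operator if (a) $U$ commutes with the natural action (by translations) of $\mathbb{Z}^{d}$, and (b) there is a finite set $S\subset\mathbb{Z}^{d}$ such that $U(\delta_{x}\otimes\phi)(y)=0$ for all $x\in\mathbb{Z}^{d}$, $y\in\mathbb{Z}^{d}\setminus(x+S)$, $\phi\in W$. The transition probability is $p_{n}(u;x)=\|(U^{n}u)(x)\|_{W}^{2}$ for integers $n\ge 0$. *)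

theory Defs
  imports "HOL-Analysis.Analysis"
begin

section \<open>Complex inner product spaces\<close>

text \<open>The norm, and hence the topology, of the underlying real normed space is required to be
  the one induced by the inner product, which is linear in its first argument.\<close>

class complex_inner = real_normed_vector +
  fixes scaleC :: "complex \<Rightarrow> 'a \<Rightarrow> 'a" (infixr "*\<^sub>C" 75)
    and cinner :: "'a \<Rightarrow> 'a \<Rightarrow> complex"
  assumes scaleC_add_right: "a *\<^sub>C (x + y) = a *\<^sub>C x + a *\<^sub>C y"
    and scaleC_add_left: "(a + b) *\<^sub>C x = a *\<^sub>C x + b *\<^sub>C x"
    and scaleC_scaleC: "a *\<^sub>C b *\<^sub>C x = (a * b) *\<^sub>C x"
    and scaleC_one: "1 *\<^sub>C x = x"
    and scaleR_scaleC: "r *\<^sub>R x = complex_of_real r *\<^sub>C x"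
    and cinner_commute: "cinner x y = cnj (cinner y x)"
    and cinner_add_left: "cinner (x + y) z = cinner x z + cinner y z"
    and cinner_scaleC_left: "cinner (a *\<^sub>C x) y = a * cinner x y"
    and cinner_self_nonneg: "0 \<le> Re (cinner x x)"
    and cinner_self_eq_zero_iff: "cinner x x = 0 \<longleftrightarrow> x = 0"
    and norm_eq_sqrt_cinner: "norm x = sqrt (Re (cinner x x))"

text \<open>Completeness is automatic in finite dimension, so the types of the following class are
  exactly the finite-dimensional complex Hilbert spaces (the zero space included).\<close>

class fin_dim_complex_hilbert = complex_inner +
  assumes finite_spanning_set: "\<exists>B. finite B \<and> (\<forall>x. \<exists>c. x = (\<Sum>b\<in>B. c b *\<^sub>C b))"

instantiation complex :: fin_dim_complex_hilbert
begin

definition scaleC_complex :: "complex \<Rightarrow> complex \<Rightarrow> complex"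
  where "scaleC_complex a x = a * x"

definition cinner_complex :: "complex \<Rightarrow> complex \<Rightarrow> complex"
  where "cinner_complex x y = x * cnj y"

instance
proof
  show "\<exists>B. finite B \<and> (\<forall>x::complex. \<exists>c. x = (\<Sum>b\<in>B. c b *\<^sub>C b))"
  proof (intro exI conjI allI)
    fix x :: complex
    show "x = (\<Sum>b\<in>{1}. x *\<^sub>C b)" by (simp add: scaleC_complex_def)
  qed simp
qed (auto simp: scaleC_complex_def cinner_complex_def algebra_simps scaleR_conv_of_real
      cmod_def power2_eq_square complex_eq_iff)

end

instantiation vec :: (fin_dim_complex_hilbert, finite) fin_dim_complex_hilbert
begin

definition scaleC_vec :: "complex \<Rightarrow> 'a ^ 'b \<Rightarrow> 'a ^ 'b"
  where "scaleC_vec a x = (\<chi> i. a *\<^sub>C x $ i)"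

definition cinner_vec :: "'a ^ 'b \<Rightarrow> 'a ^ 'b \<Rightarrow> complex"
  where "cinner_vec x y = (\<Sum>i\<in>UNIV. cinner (x $ i) (y $ i))"

instance
proof
  fix a b :: complex and r :: real and x y z :: "'a ^ 'b"
  have n: "(norm v)\<^sup>2 = Re (cinner v v)" for v :: 'a
    by (simp add: norm_eq_sqrt_cinner cinner_self_nonneg)
  show "a *\<^sub>C (x + y) = a *\<^sub>C x + a *\<^sub>C y"
    by (simp add: vec_eq_iff scaleC_vec_def scaleC_add_right)
  show "(a + b) *\<^sub>C x = a *\<^sub>C x + b *\<^sub>C x"
    by (simp add: vec_eq_iff scaleC_vec_def scaleC_add_left)
  show "a *\<^sub>C b *\<^sub>C x = (a * b) *\<^sub>C x"
    by (simp add: vec_eq_iff scaleC_vec_def scaleC_scaleC)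
  show "1 *\<^sub>C x = x"
    by (simp add: vec_eq_iff scaleC_vec_def scaleC_one)
  show "r *\<^sub>R x = complex_of_real r *\<^sub>C x"
    by (simp add: vec_eq_iff scaleC_vec_def scaleR_scaleC)
  show "cinner x y = cnj (cinner y x)"
    unfolding cinner_vec_def cnj_sum by (rule sum.cong[OF refl], rule cinner_commute)
  show "cinner (x + y) z = cinner x z + cinner y z"
    by (simp add: cinner_vec_def cinner_add_left sum.distrib)
  show "cinner (a *\<^sub>C x) y = a * cinner x y"
    by (simp add: cinner_vec_def scaleC_vec_def cinner_scaleC_left sum_distrib_left)
  show nn: "0 \<le> Re (cinner x x)"
    by (simp add: cinner_vec_def cinner_self_nonneg sum_nonneg)
  show nx: "norm x = sqrt (Re (cinner x x))"
    by (simp add: cinner_vec_def norm_vec_def L2_set_def n)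
  show "cinner x x = 0 \<longleftrightarrow> x = 0"
  proof
    assume "cinner x x = 0"
    then have "norm x = 0" using nx by simp
    then show "x = 0" by simp
  next
    have "cinner (0::'a) 0 = 0" by (simp add: cinner_self_eq_zero_iff)
    then show "x = 0 \<Longrightarrow> cinner x x = 0" by (simp add: cinner_vec_def)
  qed
next
  obtain B :: "'a set" where B: "finite B" "\<And>x. \<exists>c. x = (\<Sum>b\<in>B. c b *\<^sub>C b)"
    using finite_spanning_set by blast
  have z: "a *\<^sub>C (0::'a) = 0" for a
    using scaleC_add_right[of a "0::'a" 0] by simp
  let ?e = "\<lambda>(i, b). axis i b :: 'a ^ 'b"
  let ?B = "?e ` (UNIV \<times> (B - {0}))"
  have inj: "inj_on ?e (UNIV \<times> (B - {0}))"
    by (auto simp: inj_on_def axis_eq_axis)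
  show "\<exists>B. finite B \<and> (\<forall>x::'a ^ 'b. \<exists>c. x = (\<Sum>b\<in>B. c b *\<^sub>C b))"
  proof (intro exI[of _ ?B] conjI allI)
    show "finite ?B" using B(1) by simp
    fix x :: "'a ^ 'b"
    have "\<forall>i. \<exists>c. x $ i = (\<Sum>b\<in>B. c b *\<^sub>C b)"
      using B(2) by blast
    then obtain c where c: "\<And>i. x $ i = (\<Sum>b\<in>B. c i b *\<^sub>C b)"
      using choice[of "\<lambda>i c. x $ i = (\<Sum>b\<in>B. c b *\<^sub>C b)"] by blast
    have c': "x $ i = (\<Sum>b\<in>B-{0}. c i b *\<^sub>C b)" for i
      unfolding c[of i] by (rule sum.mono_neutral_right) (auto simp: B(1) z)
    define d where "d v = (case inv_into (UNIV \<times> (B - {0})) ?e v of (i, b) \<Rightarrow> c i b)" for v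
    have "(\<Sum>b\<in>?B. d b *\<^sub>C b) = (\<Sum>p\<in>UNIV \<times> (B - {0}). d (?e p) *\<^sub>C ?e p)"
      by (rule sum.reindex[OF inj, unfolded comp_def])
    also have "\<dots> = (\<Sum>p\<in>UNIV \<times> (B - {0}). (case p of (i, b) \<Rightarrow> c i b) *\<^sub>C ?e p)"
      by (rule sum.cong[OF refl]) (simp only: d_def inv_into_f_f[OF inj])
    also have "\<dots> = (\<Sum>i\<in>UNIV. \<Sum>b\<in>B - {0}. c i b *\<^sub>C axis i b)"
      by (simp add: sum.cartesian_product case_prod_beta)
    also have "\<dots> = x"
    proof (subst vec_eq_iff, intro allI)
      fix k
      have "(\<Sum>i\<in>UNIV. \<Sum>b\<in>B - {0}. c i b *\<^sub>C axis i b :: 'a ^ 'b) $ k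
          = (\<Sum>i\<in>UNIV. if k = i then (\<Sum>b\<in>B - {0}. c i b *\<^sub>C b) else 0)"
        unfolding sum_component scaleC_vec_def
        by (rule sum.cong[OF refl]) (auto simp: axis_def z)
      then show "(\<Sum>i\<in>UNIV. \<Sum>b\<in>B - {0}. c i b *\<^sub>C axis i b :: 'a ^ 'b) $ k = x $ k"
        by (simp add: c')
    qed
    finally show "\<exists>c. x = (\<Sum>b\<in>?B. c b *\<^sub>C b)" by (intro exI[of _ d]) (rule sym)
  qed
qed

end

section \<open>The Hilbert space of square summable functions\<close>

definition ell2 :: "('x \<Rightarrow> 'w::complex_inner) set" where
  "ell2 = {f. (\<lambda>x. (norm (f x))\<^sup>2) summable_on UNIV}"

definition ell2_inner :: "('x \<Rightarrow> 'w::complex_inner) \<Rightarrow> ('x \<Rightarrow> 'w) \<Rightarrow> complex" where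
  "ell2_inner f g = (\<Sum>\<^sub>\<infinity>x. cinner (f x) (g x))"

definition delta_tensor :: "'x \<Rightarrow> 'w::zero \<Rightarrow> 'x \<Rightarrow> 'w" where
  "delta_tensor y \<phi> = (\<lambda>x. if x = y then \<phi> else 0)"

definition translate :: "'x::ab_group_add \<Rightarrow> ('x \<Rightarrow> 'w) \<Rightarrow> 'x \<Rightarrow> 'w" where
  "translate z f = (\<lambda>x. f (x - z))"

text \<open>Operators on the Hilbert space are functions on all of \<open>'x \<Rightarrow> 'w\<close>; only their
  restriction to \<^const>\<open>ell2\<close> is constrained or used.\<close>

definition unitary_on_ell2 :: "(('x \<Rightarrow> 'w::complex_inner) \<Rightarrow> 'x \<Rightarrow> 'w) \<Rightarrow> bool" where
  "unitary_on_ell2 U \<longleftrightarrow>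
     (\<forall>f\<in>ell2. \<forall>g\<in>ell2. U (\<lambda>x. f x + g x) = (\<lambda>x. U f x + U g x)) \<and>
     (\<forall>a. \<forall>f\<in>ell2. U (\<lambda>x. a *\<^sub>C f x) = (\<lambda>x. a *\<^sub>C U f x)) \<and>
     U ` ell2 = ell2 \<and>
     (\<forall>f\<in>ell2. \<forall>g\<in>ell2. ell2_inner (U f) (U g) = ell2_inner f g)"

definition periodic_unitary_transition_operator ::
    "(((int ^ 'd::finite) \<Rightarrow> 'w::complex_inner) \<Rightarrow> (int ^ 'd) \<Rightarrow> 'w) \<Rightarrow> bool" where
  "periodic_unitary_transition_operator U \<longleftrightarrow>
     unitary_on_ell2 U \<and>
     (\<forall>z. \<forall>f\<in>ell2. U (translate z f) = translate z (U f)) \<and>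
     (\<exists>S. finite S \<and> (\<forall>x y \<phi>. y \<notin> (+) x ` S \<longrightarrow> U (delta_tensor x \<phi>) y = 0))"

definition eigenspace ::
    "(('x \<Rightarrow> 'w::complex_inner) \<Rightarrow> 'x \<Rightarrow> 'w) \<Rightarrow> complex \<Rightarrow> ('x \<Rightarrow> 'w) set" where
  "eigenspace U z = {f \<in> ell2. U f = (\<lambda>x. z *\<^sub>C f x)}"

definition eigenvalues :: "(('x \<Rightarrow> 'w::complex_inner) \<Rightarrow> 'x \<Rightarrow> 'w) \<Rightarrow> complex set" where
  "eigenvalues U = {z. \<exists>f\<in>eigenspace U z. f \<noteq> (\<lambda>x. 0)}"

definition orthogonal_projection_onto ::
    "('x \<Rightarrow> 'w::complex_inner) set \<Rightarrow> (('x \<Rightarrow> 'w) \<Rightarrow> 'x \<Rightarrow> 'w) \<Rightarrow> bool" where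
  "orthogonal_projection_onto E P \<longleftrightarrow>
     (\<forall>u\<in>ell2. P u \<in> E \<and> (\<forall>v\<in>E. ell2_inner (\<lambda>x. u x - P u x) v = 0))"

definition transition_prob ::
    "(('x \<Rightarrow> 'w::complex_inner) \<Rightarrow> 'x \<Rightarrow> 'w) \<Rightarrow> nat \<Rightarrow> ('x \<Rightarrow> 'w) \<Rightarrow> 'x \<Rightarrow> real" where
  "transition_prob U n u x = (norm ((U ^^ n) u x))\<^sup>2"

end

theory Submission
  imports Defs "HOL-Library.Poly_Mapping" "HOL-Computational_Algebra.Fundamental_Theorem_Algebra"
begin

text \<open>
  Call \<open>g\<close> escaping if \<open>U\<^sup>n g\<close> tends weakly to \<open>0\<close>. The point is that every \<open>f\<close> orthogonal to all
  escaping vectors is an eigenvector; then so is the component of \<open>u - \<pi>u\<close> orthogonal to the escaping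
  vectors, which therefore vanishes, and \<open>U\<^sup>n u = \<omega>\<^sup>n \<pi>u + U\<^sup>n (u - \<pi>u)\<close> converges in modulus at every point.

  Let the group ring \<open>\<complex>[\<int> \<times> \<int>\<^sup>d]\<close> act by \<open>(k, y) \<mapsto> U\<^sup>k T\<^sub>y\<close> and let \<open>\<partial>\<^sub>j\<close> multiply the coefficient at
  \<open>(k, y)\<close> by \<open>y\<^sub>j\<close>. If \<open>c\<close> acts as zero, averaging \<open>U\<^sup>-\<^sup>i [X\<^sub>j, c] U\<^sup>i = 0\<close> over \<open>i < n\<close>, with \<open>X\<^sub>j\<close> the
  position operator, shows that the range of \<open>\<partial>\<^sub>j c\<close> is escaping, so \<open>\<partial>\<^sub>j c\<close> kills \<open>f\<close>. Now let \<open>c\<close> merely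
  kill \<open>f\<close>. As \<open>c\<close> is algebraic over \<open>\<complex>[\<int>\<^sup>d]\<close> and acts normally, \<open>c (a + c y)\<close> acts as zero for some
  \<open>0 \<noteq> a \<in> \<complex>[\<int>\<^sup>d]\<close>; differentiating, \<open>a \<partial>\<^sub>j c\<close> kills \<open>f\<close>, hence so does \<open>\<partial>\<^sub>j c\<close> because \<open>a\<close> acts injectively.
  So the annihilator of \<open>f\<close> is stable under all \<open>\<partial>\<^sub>j\<close>, and its elements of minimal support have the
  form \<open>p(U) T\<^sub>y\<close>. As \<open>\<omega>\<close> is the only eigenvalue, \<open>p(U) f = 0\<close> forces \<open>U f = \<omega> f\<close>.
\<close>

section \<open>Complex inner product spaces\<close>

lemma cinner_add_right: "cinner x (y + z) = cinner x y + cinner (x::'a::complex_inner) z"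
  by (metis cinner_add_left cinner_commute complex_cnj_add)

lemma cinner_scaleC_right: "cinner x (a *\<^sub>C y) = cnj a * cinner (x::'a::complex_inner) y"
  by (metis cinner_scaleC_left cinner_commute complex_cnj_mult)

lemma cinner_zero_left [simp]: "cinner (0::'a::complex_inner) y = 0"
  using cinner_add_left[of "0::'a" 0 y] by simp

lemma cinner_zero_right [simp]: "cinner y (0::'a::complex_inner) = 0"
  using cinner_add_right[of y "0::'a" 0] by simp

lemma cinner_minus_left: "cinner (- x) y = - cinner (x::'a::complex_inner) y"
  using cinner_add_left[of x "- x" y] by (simp add: add_eq_0_iff)

lemma cinner_minus_right: "cinner x (- y) = - cinner (x::'a::complex_inner) y"
  using cinner_add_right[of x y "- y"] by (simp add: add_eq_0_iff)

lemma cinner_diff_left: "cinner (x - y) z = cinner x z - cinner (y::'a::complex_inner) z"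
  using cinner_add_left[of x "- y" z] by (simp add: cinner_minus_left)

lemma cinner_sum_left: "cinner (\<Sum>i\<in>I. f i) y = (\<Sum>i\<in>I. cinner (f i :: 'a::complex_inner) y)"
  by (induction I rule: infinite_finite_induct) (auto simp: cinner_add_left)

lemma cinner_sum_right: "cinner y (\<Sum>i\<in>I. f i) = (\<Sum>i\<in>I. cinner y (f i :: 'a::complex_inner))"
  by (induction I rule: infinite_finite_induct) (auto simp: cinner_add_right)

lemma cinner_self: "cinner x x = complex_of_real ((norm (x::'a::complex_inner))\<^sup>2)"
proof -
  have "Im (cinner x x) = 0"
    using cinner_commute[of x x] by (simp add: complex_eq_iff)
  then show ?thesis
    by (simp add: complex_eq_iff norm_eq_sqrt_cinner cinner_self_nonneg)
qed

lemma norm_scaleC: "norm (a *\<^sub>C x) = cmod a * norm (x::'a::complex_inner)"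
proof -
  have "complex_of_real ((norm (a *\<^sub>C x))\<^sup>2) = complex_of_real ((cmod a * norm x)\<^sup>2)"
    unfolding cinner_self[symmetric] cinner_scaleC_left cinner_scaleC_right
    by (simp add: cinner_self power_mult_distrib mult.assoc[symmetric] mult.commute
        complex_norm_square[unfolded of_real_power])
  then have "(norm (a *\<^sub>C x))\<^sup>2 = (cmod a * norm x)\<^sup>2" by (simp only: of_real_eq_iff)
  then show ?thesis by (simp add: power2_eq_iff_nonneg)
qed

lemma norm_add_sq: "(norm (x + y))\<^sup>2 = (norm x)\<^sup>2 + (norm y)\<^sup>2 + 2 * Re (cinner x (y::'a::complex_inner))"
proof -
  have "Re (cinner y x) = Re (cinner x y)" by (subst cinner_commute) simp
  moreover have "(norm z)\<^sup>2 = Re (cinner z z)" for z :: 'a by (simp add: cinner_self)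
  ultimately show ?thesis by (simp add: cinner_add_left cinner_add_right)
qed

lemma norm_diff_sq: "(norm (x - y))\<^sup>2 = (norm x)\<^sup>2 + (norm y)\<^sup>2 - 2 * Re (cinner x (y::'a::complex_inner))"
  using norm_add_sq[of x "- y"] by (simp add: cinner_minus_right)

lemma parallelogram_law:
  "(norm (x + y))\<^sup>2 + (norm (x - y))\<^sup>2 = 2 * (norm x)\<^sup>2 + 2 * (norm (y::'a::complex_inner))\<^sup>2"
  by (simp add: norm_add_sq norm_diff_sq)

lemma scaleC_zero_left [simp]: "0 *\<^sub>C x = (0::'a::complex_inner)"
  using scaleC_add_left[of 0 0 x] by simp

lemma scaleC_zero_right [simp]: "a *\<^sub>C 0 = (0::'a::complex_inner)"
  using scaleC_add_right[of a 0 "0::'a"] by simp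

lemma scaleC_minus_left: "(- a) *\<^sub>C x = - (a *\<^sub>C (x::'a::complex_inner))"
  using scaleC_add_left[of a "- a" x] by (simp add: add_eq_0_iff)

lemma scaleC_minus_right: "a *\<^sub>C (- x) = - (a *\<^sub>C (x::'a::complex_inner))"
  using scaleC_add_right[of a x "- x"] by (simp add: add_eq_0_iff)

lemma scaleC_diff_right: "a *\<^sub>C (x - y) = a *\<^sub>C x - a *\<^sub>C (y::'a::complex_inner)"
  using scaleC_add_right[of a x "- y"] by (simp add: scaleC_minus_right)

lemma scaleC_diff_left: "(a - b) *\<^sub>C x = a *\<^sub>C x - b *\<^sub>C (x::'a::complex_inner)"
  using scaleC_add_left[of a "- b" x] by (simp add: scaleC_minus_left)

lemma scaleC_sum_right: "a *\<^sub>C (\<Sum>i\<in>I. f i) = (\<Sum>i\<in>I. a *\<^sub>C (f i :: 'a::complex_inner))"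
  by (induction I rule: infinite_finite_induct) (auto simp: scaleC_add_right)

lemma scaleC_sum_left: "(\<Sum>i\<in>I. f i) *\<^sub>C x = (\<Sum>i\<in>I. f i *\<^sub>C (x :: 'a::complex_inner))"
  by (induction I rule: infinite_finite_induct) (auto simp: scaleC_add_left)

lemma scaleC_eq_0_iff: "a *\<^sub>C x = 0 \<longleftrightarrow> a = 0 \<or> x = (0::'a::complex_inner)"
  by (metis mult_eq_0_iff norm_eq_zero norm_scaleC)

text \<open>The triangle inequality is part of the normed space structure; squaring it bounds the
  real part. The modulus follows after rotating \<open>x\<close> by the phase that makes the inner
  product real and nonnegative.\<close>

lemma cauchy_schwarz: "cmod (cinner x y) \<le> norm x * norm (y::'a::complex_inner)"
proof (cases "cinner x y = 0")
  case False
  have re: "Re (cinner a b) \<le> norm a * norm b" for a b :: 'a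
  proof -
    have "(norm (a + b))\<^sup>2 \<le> (norm a + norm b)\<^sup>2"
      by (intro power_mono norm_triangle_ineq) simp
    then show ?thesis by (simp add: norm_add_sq power2_sum)
  qed
  define c where "c = cnj (cinner x y) / cmod (cinner x y)"
  have c: "c * cinner x y = cmod (cinner x y)"
    using False by (simp add: c_def complex_norm_square[symmetric] power2_eq_square mult.commute)
  have "cmod c = 1" using False by (simp add: c_def norm_divide)
  then have "Re (cinner (c *\<^sub>C x) y) \<le> norm x * norm y"
    using re[of "c *\<^sub>C x" y] by (simp add: norm_scaleC)
  then show ?thesis by (simp add: cinner_scaleC_left c)
qed simp

lemma cinner_eq_0_all: "(\<And>y. cinner x y = 0) \<Longrightarrow> x = (0::'a::complex_inner)"
  using cinner_self_eq_zero_iff by blast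

lemma tendsto_cinner_left: "(f \<longlongrightarrow> l) F \<Longrightarrow> ((\<lambda>n. cinner (f n) y) \<longlongrightarrow> cinner l (y::'a::complex_inner)) F"
proof -
  assume f: "(f \<longlongrightarrow> l) F"
  have "((\<lambda>n. norm (f n - l) * norm y) \<longlongrightarrow> 0) F"
    using f by (intro tendsto_mult_left_zero tendsto_norm_zero) (simp add: LIM_zero)
  then have "((\<lambda>n. cinner (f n) y - cinner l y) \<longlongrightarrow> 0) F"
    by (rule Lim_null_comparison[rotated])
       (simp add: cinner_diff_left[symmetric] cauchy_schwarz)
  then show ?thesis by (simp add: LIM_zero_cancel)
qed

section \<open>Orthogonal projection onto complete subspaces\<close>

definition csubspace :: "'a::complex_inner set \<Rightarrow> bool" where
  "csubspace S \<longleftrightarrow> 0 \<in> S \<and> (\<forall>x\<in>S. \<forall>y\<in>S. x + y \<in> S) \<and> (\<forall>a. \<forall>x\<in>S. a *\<^sub>C x \<in> S)"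

text \<open>A minimizing sequence for the distance from \<open>x\<close> to \<open>S\<close> is Cauchy by the parallelogram law.\<close>

lemma orthogonal_decomposition:
  fixes S :: "'a::complex_inner set"
  assumes S: "csubspace S" and c: "complete S"
  obtains p where "p \<in> S" "\<And>s. s \<in> S \<Longrightarrow> cinner (x - p) s = 0"
proof -
  have S0: "0 \<in> S" and Sadd: "\<And>a b. a \<in> S \<Longrightarrow> b \<in> S \<Longrightarrow> a + b \<in> S"
    and Ssc: "\<And>a b. b \<in> S \<Longrightarrow> a *\<^sub>C b \<in> S"
    using S by (auto simp: csubspace_def)
  define d where "d = (INF s\<in>S. (norm (x - s))\<^sup>2)"
  have dle: "d \<le> (norm (x - s))\<^sup>2" if "s \<in> S" for s
    unfolding d_def by (rule cINF_lower[OF _ that]) (auto intro!: bdd_belowI[of _ 0])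
  have "\<exists>s\<in>S. (norm (x - s))\<^sup>2 < d + 1 / Suc n" for n
  proof -
    have "bdd_below ((\<lambda>s. (norm (x - s))\<^sup>2) ` S)" by (auto intro!: bdd_belowI[of _ 0])
    then show ?thesis
      using cINF_less_iff[of S "\<lambda>s. (norm (x - s))\<^sup>2" "d + 1 / Suc n"] S0
      unfolding d_def[symmetric] by auto
  qed
  then obtain s where s: "\<And>n. s n \<in> S" "\<And>n. (norm (x - s n))\<^sup>2 < d + 1 / Suc n"
    by metis
  have dist: "(norm (s m - s n))\<^sup>2 \<le> 2 / Suc m + 2 / Suc n" for m n
  proof -
    define q where "q = (1/2::real) *\<^sub>R (s m + s n)"
    have "q \<in> S" unfolding q_def scaleR_scaleC by (intro Ssc Sadd s)
    then have "d \<le> (norm (x - q))\<^sup>2" by (rule dle)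
    moreover have "(x - s m) + (x - s n) = 2 *\<^sub>R (x - q)"
      unfolding q_def by (simp add: algebra_simps scaleR_2)
    then have "(norm ((x - s m) + (x - s n)))\<^sup>2 = 4 * (norm (x - q))\<^sup>2"
      by (simp add: power_mult_distrib)
    moreover have "(x - s m) - (x - s n) = - (s m - s n)" by simp
    then have "norm ((x - s m) - (x - s n)) = norm (s m - s n)"
      by (simp only: norm_minus_cancel)
    ultimately show ?thesis
      using parallelogram_law[of "x - s m" "x - s n"] s(2)[of m] s(2)[of n] by simp
  qed
  have "Cauchy s"
  proof (rule CauchyI)
    fix e :: real assume "0 < e"
    then obtain M where M: "4 / e\<^sup>2 < real M" "M > 0"
      by (metis reals_Archimedean2 gr0I of_nat_0 divide_pos_pos zero_less_numeral zero_less_power not_less_iff_gr_or_eq)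
    show "\<exists>M. \<forall>m\<ge>M. \<forall>n\<ge>M. norm (s m - s n) < e"
    proof (intro exI[of _ M] allI impI)
      fix m n assume mn: "M \<le> m" "M \<le> n"
      have "2 / real (Suc m) \<le> 2 / real M" "2 / real (Suc n) \<le> 2 / real M"
        using mn M(2) by (intro divide_left_mono; simp)+
      then have "(norm (s m - s n))\<^sup>2 \<le> 4 / real M"
        using dist[of m n] by simp
      also have "\<dots> < e\<^sup>2" using M \<open>0 < e\<close> by (simp add: field_simps)
      finally show "norm (s m - s n) < e"
        using \<open>0 < e\<close> by (meson less_eq_real_def power_less_imp_less_base)
    qed
  qed
  then obtain p where p: "p \<in> S" "s \<longlonglongrightarrow> p"
    using c s(1) unfolding complete_def by blast
  have "(\<lambda>n. (norm (x - s n))\<^sup>2) \<longlonglongrightarrow> (norm (x - p))\<^sup>2"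
    by (intro tendsto_intros p)
  moreover have "(\<lambda>n. d + 1 / real (Suc n)) \<longlonglongrightarrow> d + 0"
    by (intro tendsto_intros LIMSEQ_Suc[OF lim_1_over_n])
  ultimately have pd: "(norm (x - p))\<^sup>2 \<le> d"
    using s(2) by (intro LIMSEQ_le[of _ _ "\<lambda>n. d + 1 / real (Suc n)"]) (auto intro: less_imp_le)
  \<comment> \<open>Moving \<open>p\<close> by the component of \<open>x - p\<close> along
    \<open>v\<close> would lower the squared distance by that component's squared norm, so
    minimality forces \<open>a = 0\<close>.\<close>
  have "cinner (x - p) v = 0" if v: "v \<in> S" for v
  proof (cases "v = 0")
    case False
    define a where "a = cinner (x - p) v / (norm v)\<^sup>2"
    have "p + a *\<^sub>C v \<in> S" using p v by (intro Sadd Ssc)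
    then have "(norm (x - p))\<^sup>2 \<le> (norm ((x - p) - a *\<^sub>C v))\<^sup>2"
      using dle[of "p + a *\<^sub>C v"] pd unfolding diff_diff_eq by linarith
    then have "2 * Re (cnj a * cinner (x - p) v) \<le> (cmod a)\<^sup>2 * (norm v)\<^sup>2"
      by (simp add: norm_diff_sq norm_scaleC power_mult_distrib cinner_scaleC_right)
    moreover have av: "cinner (x - p) v = a * (norm v)\<^sup>2" using False by (simp add: a_def)
    moreover have "Re (cnj a * (a * (norm v)\<^sup>2)) = (cmod a)\<^sup>2 * (norm v)\<^sup>2"
      by (simp add: cmod_power2) (simp add: algebra_simps power2_eq_square)
    ultimately have "(cmod a)\<^sup>2 * (norm v)\<^sup>2 \<le> 0" by (metis add_le_same_cancel1 mult_2)
    then have "(cmod a * norm v)\<^sup>2 \<le> 0" by (simp only: power_mult_distrib)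
    then have "a = 0" using False by simp
    then show ?thesis using av by simp
  qed simp
  then show thesis using p that by blast
qed

section \<open>Finite-dimensional spaces: expansions, weak limits, completeness\<close>

text \<open>Gram-Schmidt over a finite spanning set; a vector already in the span of
  \<open>E\<close> adds nothing.\<close>

lemma orthonormal_expansion:
  obtains E :: "'w::fin_dim_complex_hilbert set"
  where "finite E" "\<And>x. x = (\<Sum>e\<in>E. cinner x e *\<^sub>C e)"
proof -
  obtain B :: "'w set" where B: "finite B" "\<And>x. \<exists>c. x = (\<Sum>b\<in>B. c b *\<^sub>C b)"
    using finite_spanning_set by blast
  have "\<exists>E::'w set. finite E \<and> (\<forall>e\<in>E. \<forall>f\<in>E. cinner e f = (if e = f then 1 else 0))
      \<and> (\<forall>b\<in>F. b = (\<Sum>e\<in>E. cinner b e *\<^sub>C e))" if "finite F" for F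
    using that
  proof induction
    case (insert b F)
    then obtain E :: "'w set" where E: "finite E"
      "\<forall>e\<in>E. \<forall>f\<in>E. cinner e f = (if e = f then 1 else 0)"
      "\<forall>b\<in>F. b = (\<Sum>e\<in>E. cinner b e *\<^sub>C e)" by blast
    define d where "d = b - (\<Sum>e\<in>E. cinner b e *\<^sub>C e)"
    have d: "cinner d f = 0" if "f \<in> E" for f
    proof -
      have "(\<Sum>e\<in>E. cinner b e * cinner e f) = (\<Sum>e\<in>E. if e = f then cinner b e else 0)"
        using E(2) that by (intro sum.cong) auto
      then show ?thesis using E(1) that
        by (simp add: d_def cinner_diff_left cinner_sum_left cinner_scaleC_left)
    qed
    show ?case
    proof (cases "d = 0")
      case True
      then show ?thesis using E by (intro exI[of _ E]) (simp add: d_def)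
    next
      case False
      define v where "v = complex_of_real (1 / norm d) *\<^sub>C d"
      have vd: "cinner d v = complex_of_real (norm d)" and vv: "cinner v v = 1"
        using False by (simp_all add: v_def cinner_scaleC_left cinner_scaleC_right cinner_self power2_eq_square
            norm_scaleC norm_divide)
      have ve: "cinner v e = 0" "cinner e v = 0" if "e \<in> E" for e
      proof -
        show "cinner v e = 0" using d[OF that] by (simp add: v_def cinner_scaleC_left)
        then show "cinner e v = 0" by (subst cinner_commute) simp
      qed
      then have vE: "v \<notin> E" using vv by force
      have "c = (\<Sum>e\<in>insert v E. cinner c e *\<^sub>C e)" if c: "c \<in> insert b F" for c
      proof (cases "c \<in> F")
        case True
        then have "cinner c v = cinner (\<Sum>e\<in>E. cinner c e *\<^sub>C e) v" using E(3) by metis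
        also have "\<dots> = 0" by (simp add: cinner_sum_left cinner_scaleC_left ve)
        finally show ?thesis using E(1,3) vE True by simp
      next
        case False
        have b: "b = d + (\<Sum>e\<in>E. cinner b e *\<^sub>C e)" by (simp add: d_def)
        then have "cinner b v = cinner (d + (\<Sum>e\<in>E. cinner b e *\<^sub>C e)) v" by metis
        also have "\<dots> = norm d"
          by (simp add: cinner_add_left cinner_sum_left cinner_scaleC_left ve vd)
        finally have "cinner b v *\<^sub>C v = d"
          using \<open>d \<noteq> 0\<close> by (simp add: v_def scaleC_scaleC scaleC_one)
        then show ?thesis using b E(1) vE False c by simp
      qed
      then show ?thesis
        using E(1,2) ve vv by (intro exI[of _ "insert v E"]) auto
    qed
  qed auto
  from this[OF B(1)] obtain E :: "'w set" where E: "finite E"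
    "\<And>b. b \<in> B \<Longrightarrow> b = (\<Sum>e\<in>E. cinner b e *\<^sub>C e)" by blast
  have "x = (\<Sum>e\<in>E. cinner x e *\<^sub>C e)" for x
  proof -
    obtain c where c: "x = (\<Sum>b\<in>B. c b *\<^sub>C b)" using B(2) by blast
    also have "\<dots> = (\<Sum>b\<in>B. c b *\<^sub>C (\<Sum>e\<in>E. cinner b e *\<^sub>C e))"
      using E(2) by (intro sum.cong refl) metis
    also have "\<dots> = (\<Sum>e\<in>E. (\<Sum>b\<in>B. c b * cinner b e) *\<^sub>C e)"
      unfolding scaleC_sum_right scaleC_sum_left scaleC_scaleC by (rule sum.swap)
    also have "\<dots> = (\<Sum>e\<in>E. cinner x e *\<^sub>C e)"
      unfolding c by (simp add: cinner_sum_left cinner_scaleC_left)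
    finally show ?thesis .
  qed
  with E(1) show thesis by (rule that)
qed

lemma tendsto_scaleC_left: "(f \<longlongrightarrow> l) F \<Longrightarrow> ((\<lambda>n. f n *\<^sub>C x) \<longlongrightarrow> l *\<^sub>C (x::'a::complex_inner)) F"
proof -
  assume "(f \<longlongrightarrow> l) F"
  then have "((\<lambda>n. cmod (f n - l) * norm x) \<longlongrightarrow> 0) F"
    by (intro tendsto_mult_left_zero tendsto_norm_zero) (simp add: LIM_zero)
  then have "((\<lambda>n. f n *\<^sub>C x - l *\<^sub>C x) \<longlongrightarrow> 0) F"
    by (rule Lim_null_comparison[rotated]) (simp add: scaleC_diff_left[symmetric] norm_scaleC)
  then show ?thesis by (rule LIM_zero_cancel)
qed

text \<open>An orthonormal expansion turns convergence of coefficients into convergence of vectors.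
  This serves both completeness of \<open>'w\<close> and, at the end, convergence at a single
  site.\<close>

lemma tendsto_fin_dim_if_weakly:
  fixes f :: "'n \<Rightarrow> 'w::fin_dim_complex_hilbert"
  assumes "\<And>\<phi>. \<exists>l. ((\<lambda>n. cinner (f n) \<phi>) \<longlongrightarrow> l) F"
  shows "\<exists>l. (f \<longlongrightarrow> l) F"
proof -
  obtain E :: "'w set" where E: "finite E" "\<And>x. x = (\<Sum>e\<in>E. cinner x e *\<^sub>C e)"
    by (rule orthonormal_expansion) (rule that)
  obtain l where l: "\<And>\<phi>. ((\<lambda>n. cinner (f n) \<phi>) \<longlongrightarrow> l \<phi>) F" using assms by metis
  have "((\<lambda>n. \<Sum>e\<in>E. cinner (f n) e *\<^sub>C e) \<longlongrightarrow> (\<Sum>e\<in>E. l e *\<^sub>C e)) F"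
    by (intro tendsto_sum tendsto_scaleC_left l)
  then show ?thesis unfolding E(2)[symmetric] by blast
qed

lemma complete_fin_dim: "complete (UNIV :: 'w::fin_dim_complex_hilbert set)"
  unfolding complete_def
proof (intro allI impI, elim conjE)
  fix f :: "nat \<Rightarrow> 'w" assume f: "Cauchy f"
  have "\<exists>l. (\<lambda>n. cinner (f n) \<phi>) \<longlonglongrightarrow> l" for \<phi>
  proof -
    have "Cauchy (\<lambda>n. cinner (f n) \<phi>)"
    proof (rule CauchyI)
      fix r :: real assume r: "0 < r"
      then have "0 < r / (norm \<phi> + 1)" by (simp add: add_nonneg_pos)
      then obtain M where M: "\<forall>m\<ge>M. \<forall>n\<ge>M. norm (f m - f n) < r / (norm \<phi> + 1)"
        using CauchyD[OF f] by blast
      have "cmod (cinner (f m) \<phi> - cinner (f n) \<phi>) < r" if "m \<ge> M" "n \<ge> M" for m n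
      proof -
        have "cmod (cinner (f m) \<phi> - cinner (f n) \<phi>) \<le> norm (f m - f n) * norm \<phi>"
          using cauchy_schwarz[of "f m - f n" \<phi>] by (simp add: cinner_diff_left)
        also have "\<dots> \<le> norm (f m - f n) * (norm \<phi> + 1)" by (simp add: mult_left_mono)
        also have "\<dots> < r" using M that by (simp add: pos_less_divide_eq add_nonneg_pos)
        finally show ?thesis .
      qed
      then show "\<exists>M. \<forall>m\<ge>M. \<forall>n\<ge>M. norm (cinner (f m) \<phi> - cinner (f n) \<phi>) < r" by blast
    qed
    then show ?thesis using Cauchy_convergent convergent_def by blast
  qed
  then show "\<exists>l\<in>UNIV. f \<longlonglongrightarrow> l" using tendsto_fin_dim_if_weakly by blast
qed

lemma tendsto_0_if_weakly:
  fixes f :: "'n \<Rightarrow> 'w::fin_dim_complex_hilbert"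
  assumes "\<And>\<phi>. ((\<lambda>n. cinner (f n) \<phi>) \<longlongrightarrow> 0) F"
  shows "(f \<longlongrightarrow> 0) F"
proof (cases "F = bot")
  case False
  obtain l where l: "(f \<longlongrightarrow> l) F" using tendsto_fin_dim_if_weakly[of f F] assms by blast
  have "cinner l \<phi> = 0" for \<phi>
    using tendsto_unique[OF False tendsto_cinner_left[OF l] assms] .
  then have "l = 0" by (rule cinner_eq_0_all)
  then show ?thesis using l by simp
qed simp

section \<open>The space of square summable functions as a type\<close>

text \<open>Phrasing membership by \<open>L2_set\<close> on finite sets makes Minkowski's inequality
  for finite sums available, which gives closure under addition.\<close>

lemma ell2_iff_bdd:
  "f \<in> ell2 \<longleftrightarrow> (\<exists>M. \<forall>F. finite F \<longrightarrow> L2_set (\<lambda>x. norm (f x)) F \<le> M)"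
proof
  assume "f \<in> ell2"
  then have s: "(\<lambda>x. (norm (f x))\<^sup>2) summable_on UNIV" by (simp add: ell2_def)
  show "\<exists>M. \<forall>F. finite F \<longrightarrow> L2_set (\<lambda>x. norm (f x)) F \<le> M"
    unfolding L2_set_def
    by (intro exI[of _ "sqrt (\<Sum>\<^sub>\<infinity>x. (norm (f x))\<^sup>2)"] allI impI real_sqrt_le_mono
        finite_sum_le_infsum[OF s]) auto
next
  assume "\<exists>M. \<forall>F. finite F \<longrightarrow> L2_set (\<lambda>x. norm (f x)) F \<le> M"
  then obtain M where M: "\<And>F. finite F \<Longrightarrow> L2_set (\<lambda>x. norm (f x)) F \<le> M" by blast
  have "(\<Sum>x\<in>F. (norm (f x))\<^sup>2) \<le> M\<^sup>2" if "finite F" for F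
  proof -
    have "(L2_set (\<lambda>x. norm (f x)) F)\<^sup>2 \<le> M\<^sup>2"
      using M[OF that] by (intro power_mono) (auto simp: L2_set_def sum_nonneg)
    then show ?thesis by (simp add: L2_set_def sum_nonneg)
  qed
  then show "f \<in> ell2"
    unfolding ell2_def
    by (auto intro!: nonneg_bdd_above_summable_on bdd_aboveI[of _ "M\<^sup>2"])
qed

lemma ell2_zero: "(\<lambda>x. 0) \<in> ell2"
  by (auto simp: ell2_iff_bdd L2_set_def)

lemma ell2_add: "f \<in> ell2 \<Longrightarrow> g \<in> ell2 \<Longrightarrow> (\<lambda>x. f x + g x) \<in> ell2"
proof -
  assume "f \<in> ell2" "g \<in> ell2"
  then obtain M N where M: "\<And>F. finite F \<Longrightarrow> L2_set (\<lambda>x. norm (f x)) F \<le> M"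
    and N: "\<And>F. finite F \<Longrightarrow> L2_set (\<lambda>x. norm (g x)) F \<le> N"
    unfolding ell2_iff_bdd by blast
  have "L2_set (\<lambda>x. norm (f x + g x)) F \<le> M + N" if "finite F" for F
  proof -
    have "L2_set (\<lambda>x. norm (f x + g x)) F \<le> L2_set (\<lambda>x. norm (f x) + norm (g x)) F"
      by (intro L2_set_mono norm_triangle_ineq) auto
    also have "\<dots> \<le> L2_set (\<lambda>x. norm (f x)) F + L2_set (\<lambda>x. norm (g x)) F"
      by (rule L2_set_triangle_ineq)
    finally show ?thesis using M[OF that] N[OF that] by linarith
  qed
  then show ?thesis unfolding ell2_iff_bdd by blast
qed

lemma ell2_scaleC: "f \<in> ell2 \<Longrightarrow> (\<lambda>x. a *\<^sub>C f x) \<in> ell2"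
  unfolding ell2_def by (simp add: norm_scaleC power_mult_distrib summable_on_cmult_right)

lemma ell2_uminus: "f \<in> ell2 \<Longrightarrow> (\<lambda>x. - f x) \<in> ell2"
  unfolding ell2_def by simp

lemma ell2_cinner_summable:
  fixes f g :: "'x \<Rightarrow> 'w::complex_inner"
  assumes "f \<in> ell2" "g \<in> ell2"
  shows "(\<lambda>x. cinner (f x) (g x)) summable_on UNIV"
proof (rule abs_summable_summable, rule summable_on_comparison_test)
  show "(\<lambda>x. (norm (f x))\<^sup>2 + (norm (g x))\<^sup>2) summable_on UNIV"
    using assms by (auto simp: ell2_def intro: summable_on_add)
  fix x
  have "2 * (norm (f x) * norm (g x)) \<le> (norm (f x))\<^sup>2 + (norm (g x))\<^sup>2"
    using sum_squares_bound[of "norm (f x)" "norm (g x)"] by simp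
  moreover have "0 \<le> norm (f x) * norm (g x)" by simp
  ultimately show "cmod (cinner (f x) (g x)) \<le> (norm (f x))\<^sup>2 + (norm (g x))\<^sup>2"
    using cauchy_schwarz[of "f x" "g x"] by linarith
qed auto

lemma delta_tensor_ell2: "delta_tensor y \<phi> \<in> (ell2 :: ('x \<Rightarrow> 'w::complex_inner) set)"
  unfolding ell2_def mem_Collect_eq delta_tensor_def
  by (rule finite_nonzero_values_imp_summable_on) (auto intro: finite_subset[of _ "{y}"])

text \<open>As a type, the Hilbert space can be an instance of \<open>complex_inner\<close>, so the
  abstract lemmas on projections and adjoints apply to it.\<close>

typedef (overloaded) ('x, 'w::complex_inner) l2 = "ell2 :: ('x \<Rightarrow> 'w) set"
  morphisms l2_apply Abs_l2
  using ell2_zero by blast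

lemmas l2_apply_Abs [simp] = Abs_l2_inverse

lemma l2_eqI: "(\<And>x. l2_apply f x = l2_apply g x) \<Longrightarrow> f = g"
  using l2_apply_inject by blast

instantiation l2 :: (type, complex_inner) complex_inner
begin

definition zero_l2 :: "('a, 'b) l2" where "0 = Abs_l2 (\<lambda>x. 0)"
definition plus_l2 :: "('a, 'b) l2 \<Rightarrow> ('a, 'b) l2 \<Rightarrow> ('a, 'b) l2"
  where "f + g = Abs_l2 (\<lambda>x. l2_apply f x + l2_apply g x)"
definition uminus_l2 :: "('a, 'b) l2 \<Rightarrow> ('a, 'b) l2"
  where "- f = Abs_l2 (\<lambda>x. - l2_apply f x)"
definition minus_l2 :: "('a, 'b) l2 \<Rightarrow> ('a, 'b) l2 \<Rightarrow> ('a, 'b) l2"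
  where "f - g = f + (- g)" for f g :: "('a, 'b) l2"
definition scaleC_l2 :: "complex \<Rightarrow> ('a, 'b) l2 \<Rightarrow> ('a, 'b) l2"
  where "a *\<^sub>C f = Abs_l2 (\<lambda>x. a *\<^sub>C l2_apply f x)"
definition scaleR_l2 :: "real \<Rightarrow> ('a, 'b) l2 \<Rightarrow> ('a, 'b) l2"
  where "r *\<^sub>R f = complex_of_real r *\<^sub>C f" for f :: "('a, 'b) l2"
definition cinner_l2 :: "('a, 'b) l2 \<Rightarrow> ('a, 'b) l2 \<Rightarrow> complex"
  where "cinner f g = ell2_inner (l2_apply f) (l2_apply g)"
definition norm_l2 :: "('a, 'b) l2 \<Rightarrow> real"
  where "norm f = sqrt (\<Sum>\<^sub>\<infinity>x. (norm (l2_apply f x))\<^sup>2)"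
definition dist_l2 :: "('a, 'b) l2 \<Rightarrow> ('a, 'b) l2 \<Rightarrow> real"
  where "dist f g = norm (f - g)" for f g :: "('a, 'b) l2"
definition sgn_l2 :: "('a, 'b) l2 \<Rightarrow> ('a, 'b) l2"
  where "sgn f = inverse (norm f) *\<^sub>R f" for f :: "('a, 'b) l2"
definition uniformity_l2 :: "(('a, 'b) l2 \<times> ('a, 'b) l2) filter"
  where "uniformity_l2 = (INF e\<in>{0<..}. principal {(x, y). dist x y < e})"
definition open_l2 :: "('a, 'b) l2 set \<Rightarrow> bool"
  where "open_l2 U \<longleftrightarrow> (\<forall>x\<in>U. eventually (\<lambda>(x', y). x' = x \<longrightarrow> y \<in> U) uniformity)"

lemma l2_apply_zero [simp]: "l2_apply (0::('a,'b) l2) x = 0"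
  by (simp add: zero_l2_def ell2_zero)

lemma l2_apply_add [simp]: "l2_apply (f + g) x = l2_apply f x + l2_apply (g::('a,'b) l2) x"
  by (simp add: plus_l2_def ell2_add l2_apply)

lemma l2_apply_uminus [simp]: "l2_apply (- f) x = - l2_apply (f::('a,'b) l2) x"
  by (simp add: uminus_l2_def ell2_uminus l2_apply)

lemma l2_apply_diff [simp]: "l2_apply (f - g) x = l2_apply f x - l2_apply (g::('a,'b) l2) x"
  by (simp add: minus_l2_def)

lemma l2_apply_scaleC [simp]: "l2_apply (a *\<^sub>C f) x = a *\<^sub>C l2_apply (f::('a,'b) l2) x"
  by (simp add: scaleC_l2_def ell2_scaleC l2_apply)

lemma l2_apply_scaleR [simp]: "l2_apply (r *\<^sub>R f) x = r *\<^sub>R l2_apply (f::('a,'b) l2) x"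
  by (simp add: scaleR_l2_def scaleR_scaleC)

lemma l2_summable: "(\<lambda>x. (norm (l2_apply (f::('a,'b) l2) x))\<^sup>2) summable_on UNIV"
  using l2_apply[of f] by (simp add: ell2_def)

lemma L2_set_le_norm: "finite F \<Longrightarrow> L2_set (\<lambda>x. norm (l2_apply f x)) F \<le> norm (f::('a,'b) l2)"
  unfolding L2_set_def norm_l2_def
  by (intro real_sqrt_le_mono finite_sum_le_infsum[OF l2_summable]) auto

lemma norm_l2_leI:
  assumes "\<And>F. finite F \<Longrightarrow> L2_set (\<lambda>x. norm (l2_apply f x)) F \<le> M"
  shows "norm (f::('a,'b) l2) \<le> M"
proof -
  have M0: "0 \<le> M" using assms[of "{}"] by simp
  have "(\<Sum>\<^sub>\<infinity>x. (norm (l2_apply f x))\<^sup>2) \<le> M\<^sup>2"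
  proof (rule infsum_le_finite_sums[OF l2_summable])
    fix F :: "'a set" assume "finite F"
    have "(L2_set (\<lambda>x. norm (l2_apply f x)) F)\<^sup>2 \<le> M\<^sup>2"
      using assms[OF \<open>finite F\<close>] by (intro power_mono) (auto simp: L2_set_def sum_nonneg)
    then show "(\<Sum>x\<in>F. (norm (l2_apply f x))\<^sup>2) \<le> M\<^sup>2" by (simp add: L2_set_def sum_nonneg)
  qed
  then show ?thesis unfolding norm_l2_def using M0 by (simp add: real_le_lsqrt infsum_nonneg)
qed

lemma cinner_l2_self: "cinner f f = complex_of_real ((norm f)\<^sup>2)" for f :: "('a, 'b) l2"
proof -
  have "(\<Sum>\<^sub>\<infinity>x. complex_of_real ((norm (l2_apply f x))\<^sup>2)) = complex_of_real (\<Sum>\<^sub>\<infinity>x. (norm (l2_apply f x))\<^sup>2)"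
    by (rule infsumI, rule has_sum_of_real, rule has_sum_infsum, rule l2_summable)
  then show ?thesis
    unfolding cinner_l2_def ell2_inner_def norm_l2_def cinner_self
    by (simp add: infsum_nonneg)
qed

lemma norm_apply_le: "norm (l2_apply f x) \<le> norm (f::('a,'b) l2)"
  using L2_set_le_norm[of "{x}" f] by simp

lemma norm_l2_eq_0: "norm f = 0 \<longleftrightarrow> f = (0::('a, 'b) l2)"
proof
  assume "norm f = 0"
  then have "norm (l2_apply f x) \<le> 0" for x by (metis norm_apply_le)
  then show "f = 0" by (intro l2_eqI) simp
qed (simp add: norm_l2_def)

instance
proof
  fix a b :: complex and r s :: real and f g h :: "('a, 'b) l2" and U :: "('a, 'b) l2 set"
  show "f + g + h = f + (g + h)" "f + g = g + f" "0 + f = f" "- f + f = 0" "f - g = f + - g"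
    by (rule l2_eqI; simp)+
  show "r *\<^sub>R (f + g) = r *\<^sub>R f + r *\<^sub>R g" "(r + s) *\<^sub>R f = r *\<^sub>R f + s *\<^sub>R f"
    "r *\<^sub>R s *\<^sub>R f = (r * s) *\<^sub>R f" "1 *\<^sub>R f = f"
    by (rule l2_eqI; simp add: scaleR_add_right scaleR_add_left)+
  show "a *\<^sub>C (f + g) = a *\<^sub>C f + a *\<^sub>C g" "(a + b) *\<^sub>C f = a *\<^sub>C f + b *\<^sub>C f"
    "a *\<^sub>C b *\<^sub>C f = (a * b) *\<^sub>C f" "1 *\<^sub>C f = f"
    by (rule l2_eqI; simp add: scaleC_add_right scaleC_add_left scaleC_scaleC scaleC_one)+
  show "r *\<^sub>R f = complex_of_real r *\<^sub>C f" by (rule scaleR_l2_def)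
  show "dist f g = norm (f - g)" by (rule dist_l2_def)
  show "sgn f = inverse (norm f) *\<^sub>R f" by (rule sgn_l2_def)
  show "uniformity = (INF e\<in>{0<..}. principal {(x::('a, 'b) l2, y). dist x y < e})"
    by (rule uniformity_l2_def)
  show "open U \<longleftrightarrow> (\<forall>x\<in>U. eventually (\<lambda>(x', y). x' = x \<longrightarrow> y \<in> U) uniformity)"
    by (rule open_l2_def)
  show "norm f = 0 \<longleftrightarrow> f = 0" by (rule norm_l2_eq_0)
  show "norm (f + g) \<le> norm f + norm g"
  proof (rule norm_l2_leI)
    fix F :: "'a set" assume F: "finite F"
    have "L2_set (\<lambda>x. norm (l2_apply (f + g) x)) F
        \<le> L2_set (\<lambda>x. norm (l2_apply f x) + norm (l2_apply g x)) F"
      by (intro L2_set_mono) (auto intro: norm_triangle_ineq)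
    also have "\<dots> \<le> L2_set (\<lambda>x. norm (l2_apply f x)) F + L2_set (\<lambda>x. norm (l2_apply g x)) F"
      by (rule L2_set_triangle_ineq)
    also have "\<dots> \<le> norm f + norm g" by (intro add_mono L2_set_le_norm F)
    finally show "L2_set (\<lambda>x. norm (l2_apply (f + g) x)) F \<le> norm f + norm g" .
  qed
  show "norm (r *\<^sub>R f) = \<bar>r\<bar> * norm f"
    unfolding norm_l2_def
    by (simp add: power_mult_distrib infsum_cmult_right' real_sqrt_mult)
  show "cinner f g = cnj (cinner g f)"
    unfolding cinner_l2_def ell2_inner_def infsum_cnj[symmetric]
    by (rule infsum_cong, rule cinner_commute)
  show "cinner (f + g) h = cinner f h + cinner g h"
    unfolding cinner_l2_def ell2_inner_def l2_apply_add cinner_add_left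
    by (intro infsum_add ell2_cinner_summable l2_apply)
  show "cinner (a *\<^sub>C f) g = a * cinner f g"
    unfolding cinner_l2_def ell2_inner_def l2_apply_scaleC cinner_scaleC_left
    by (intro infsum_cmult_right ell2_cinner_summable l2_apply)
  show "0 \<le> Re (cinner f f)" by (simp add: cinner_l2_self)
  show "cinner f f = 0 \<longleftrightarrow> f = 0" by (simp add: cinner_l2_self norm_l2_eq_0)
  show "norm f = sqrt (Re (cinner f f))"
    by (simp add: cinner_l2_self norm_l2_def infsum_nonneg)
qed

end

lemma l2_apply_sum: "l2_apply (\<Sum>i\<in>I. f i) x = (\<Sum>i\<in>I. l2_apply (f i) x)"
  by (induction I rule: infinite_finite_induct) auto

text \<open>Pointwise limits exist because the value space is complete; the Cauchy estimates survive
  the limit on each finite set of sites, hence in norm.\<close>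

instance l2 :: (type, fin_dim_complex_hilbert) complete_space
proof
  fix X :: "nat \<Rightarrow> ('a, 'b) l2"
  assume X: "Cauchy X"
  have "\<exists>l. (\<lambda>n. l2_apply (X n) x) \<longlonglongrightarrow> l" for x
  proof -
    have "Cauchy (\<lambda>n. l2_apply (X n) x)"
    proof (rule CauchyI)
      fix e :: real assume "0 < e"
      then obtain M where M: "\<forall>m\<ge>M. \<forall>n\<ge>M. norm (X m - X n) < e" using CauchyD[OF X] by blast
      have "norm (l2_apply (X m) x - l2_apply (X n) x) \<le> norm (X m - X n)" for m n
        using norm_apply_le[of "X m - X n" x] by simp
      then show "\<exists>M. \<forall>m\<ge>M. \<forall>n\<ge>M. norm (l2_apply (X m) x - l2_apply (X n) x) < e"
        using M by (meson le_less_trans)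
    qed
    then show ?thesis using complete_fin_dim unfolding complete_def by blast
  qed
  then obtain g where g: "\<And>x. (\<lambda>n. l2_apply (X n) x) \<longlonglongrightarrow> g x" by metis
  have lim: "L2_set (\<lambda>x. norm (l2_apply h x - g x)) F \<le> e"
    if "eventually (\<lambda>n. norm (h - X n) \<le> e) sequentially" "finite F" for h e F
  proof (rule tendsto_upperbound)
    show "(\<lambda>n. L2_set (\<lambda>x. norm (l2_apply h x - l2_apply (X n) x)) F)
        \<longlonglongrightarrow> L2_set (\<lambda>x. norm (l2_apply h x - g x)) F"
      unfolding L2_set_def by (intro tendsto_intros g)
    show "eventually (\<lambda>n. L2_set (\<lambda>x. norm (l2_apply h x - l2_apply (X n) x)) F \<le> e) sequentially"
      using that(1)
    proof eventually_elim
      fix n assume "norm (h - X n) \<le> e"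
      then show "L2_set (\<lambda>x. norm (l2_apply h x - l2_apply (X n) x)) F \<le> e"
        using L2_set_le_norm[OF that(2), of "h - X n"] by simp
    qed
  qed simp
  obtain K where K: "\<And>n. norm (X n) \<le> K"
    using Cauchy_Bseq[OF X] by (auto simp: Bseq_def)
  have "g \<in> ell2"
    unfolding ell2_iff_bdd
  proof (intro exI[of _ K] allI impI)
    fix F :: "'a set" assume "finite F"
    then show "L2_set (\<lambda>x. norm (g x)) F \<le> K" using lim[of 0 K F] K by simp
  qed
  then have G: "l2_apply (Abs_l2 g) x = g x" for x by simp
  have "X \<longlonglongrightarrow> Abs_l2 g"
  proof (rule LIMSEQ_I)
    fix r :: real assume "0 < r"
    then have "0 < r / 2" by simp
    then obtain M where M: "\<forall>m\<ge>M. \<forall>n\<ge>M. norm (X m - X n) < r / 2" using CauchyD[OF X] by blast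
    have "norm (X m - Abs_l2 g) < r" if "m \<ge> M" for m
    proof -
      have "norm (X m - Abs_l2 g) \<le> r / 2"
      proof (rule norm_l2_leI)
        fix F :: "'a set" assume F: "finite F"
        have "eventually (\<lambda>n. norm (X m - X n) \<le> r / 2) sequentially"
          using M that by (auto simp: eventually_sequentially intro!: exI[of _ M] less_imp_le)
        from lim[OF this F] show "L2_set (\<lambda>x. norm (l2_apply (X m - Abs_l2 g) x)) F \<le> r / 2"
          by (simp add: G)
      qed
      then show ?thesis using \<open>0 < r\<close> by simp
    qed
    then show "\<exists>no. \<forall>n\<ge>no. norm (X n - Abs_l2 g) < r" by blast
  qed
  then show "convergent X" by (rule convergentI)
qed

section \<open>Finitely supported elements\<close>

definition delta :: "'x \<Rightarrow> 'w::complex_inner \<Rightarrow> ('x, 'w) l2" where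
  "delta y \<phi> = Abs_l2 (delta_tensor y \<phi>)"

lemma delta_apply: "l2_apply (delta y \<phi>) x = (if x = y then \<phi> else 0)"
  by (simp add: delta_def delta_tensor_ell2) (simp add: delta_tensor_def)

lemma cinner_delta_right: "cinner f (delta y \<phi>) = cinner (l2_apply f y) \<phi>"
proof -
  have "cinner f (delta y \<phi>) = (\<Sum>\<^sub>\<infinity>x\<in>{y}. cinner (l2_apply f x) \<phi>)"
    unfolding cinner_l2_def ell2_inner_def
    by (rule infsum_cong_neutral) (auto simp: delta_apply)
  then show ?thesis by simp
qed

lemma cinner_delta_left: "cinner (delta y \<phi>) f = cinner \<phi> (l2_apply f y)"
  using cinner_delta_right[of f y \<phi>] by (metis cinner_commute)

lemma norm_delta [simp]: "norm (delta y \<phi>) = norm \<phi>"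
  by (simp add: norm_eq_sqrt_cinner cinner_delta_right delta_apply)

lemma delta_add: "delta y (\<phi> + \<psi>) = delta y \<phi> + delta y \<psi>"
  by (rule l2_eqI) (simp add: delta_apply)

lemma delta_scaleC: "delta y (a *\<^sub>C \<phi>) = a *\<^sub>C delta y \<phi>"
  by (rule l2_eqI) (simp add: delta_apply)

definition supp :: "('x, 'w::complex_inner) l2 \<Rightarrow> 'x set" where
  "supp f = {x. l2_apply f x \<noteq> 0}"

definition fin_supp :: "('x, 'w::complex_inner) l2 set" where
  "fin_supp = {f. finite (supp f)}"

lemma fin_supp_delta [simp]: "delta y \<phi> \<in> fin_supp"
  by (auto simp: fin_supp_def supp_def delta_apply intro: finite_subset[of _ "{y}"])

lemma fin_supp_0 [simp]: "0 \<in> fin_supp"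
  by (simp add: fin_supp_def supp_def)

lemma fin_supp_add: "f \<in> fin_supp \<Longrightarrow> g \<in> fin_supp \<Longrightarrow> f + g \<in> fin_supp"
  unfolding fin_supp_def mem_Collect_eq
  by (rule finite_subset[of _ "supp f \<union> supp g"]) (auto simp: supp_def)

lemma fin_supp_scaleC: "f \<in> fin_supp \<Longrightarrow> a *\<^sub>C f \<in> fin_supp"
  unfolding fin_supp_def mem_Collect_eq
  by (rule finite_subset[of _ "supp f"]) (auto simp: supp_def)

lemma fin_supp_sum: "(\<And>i. i \<in> I \<Longrightarrow> f i \<in> fin_supp) \<Longrightarrow> (\<Sum>i\<in>I. f i) \<in> fin_supp"
  by (induction I rule: infinite_finite_induct) (auto simp: fin_supp_add)

lemma fin_supp_expand: "f \<in> fin_supp \<Longrightarrow> f = (\<Sum>y\<in>supp f. delta y (l2_apply f y))"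
proof (rule l2_eqI)
  fix x assume "f \<in> fin_supp"
  then have "finite (supp f)" by (simp add: fin_supp_def)
  then have "(\<Sum>y\<in>supp f. if x = y then l2_apply f y else 0) = l2_apply f x"
    by (simp add: supp_def)
  then show "l2_apply f x = l2_apply (\<Sum>y\<in>supp f. delta y (l2_apply f y)) x"
    by (simp add: l2_apply_sum delta_apply)
qed

text \<open>Density of the finitely supported vectors in the form used below: test against the delta
  at \<open>x\<close> that carries the value of \<open>f\<close> there.\<close>

lemma eq_0_if_orthogonal_fin_supp:
  "(\<And>\<phi>. \<phi> \<in> fin_supp \<Longrightarrow> cinner f \<phi> = 0) \<Longrightarrow> f = 0"
proof (rule l2_eqI)
  fix x assume "\<And>\<phi>. \<phi> \<in> fin_supp \<Longrightarrow> cinner f \<phi> = 0"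
  from this[OF fin_supp_delta[of x "l2_apply f x"]]
  show "l2_apply f x = l2_apply 0 x"
    by (simp add: cinner_delta_right cinner_self_eq_zero_iff)
qed

section \<open>Unitary representations of abelian groups\<close>

lemma poly_mapping_expand:
  "c = (\<Sum>g\<in>Poly_Mapping.keys c. Poly_Mapping.single g (Poly_Mapping.lookup c g))"
  by (rule poly_mapping_eqI)
     (simp add: lookup_sum lookup_single when_def in_keys_iff)

lemma poly_mapping_additive_induct [case_names zero single add]:
  assumes "P 0" "\<And>g v. P (Poly_Mapping.single g v)" "\<And>a b. P a \<Longrightarrow> P b \<Longrightarrow> P (a + b)"
  shows "P (c :: 'g \<Rightarrow>\<^sub>0 'v::comm_monoid_add)"
proof -
  have "P (\<Sum>g\<in>K. Poly_Mapping.single g (Poly_Mapping.lookup c g))" for K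
    by (induction K rule: infinite_finite_induct) (auto intro: assms)
  then show ?thesis using poly_mapping_expand[of c] by metis
qed

text \<open>One definition serves three purposes: an additive weight gives a derivation, a character
  gives an automorphism of the group ring, a constant gives a scalar multiple.\<close>

definition weight_deriv :: "('g \<Rightarrow> complex) \<Rightarrow> ('g \<Rightarrow>\<^sub>0 complex) \<Rightarrow> ('g \<Rightarrow>\<^sub>0 complex)" where
  "weight_deriv d c = (\<Sum>g\<in>Poly_Mapping.keys c. Poly_Mapping.single g (d g * Poly_Mapping.lookup c g))"

lemma lookup_weight_deriv:
  "Poly_Mapping.lookup (weight_deriv d c) g = d g * Poly_Mapping.lookup c g"
  by (simp add: weight_deriv_def lookup_sum lookup_single when_def in_keys_iff)

lemma weight_deriv_add: "weight_deriv d (a + b) = weight_deriv d a + weight_deriv d b"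
  by (rule poly_mapping_eqI) (simp add: lookup_weight_deriv lookup_add algebra_simps)

lemma weight_deriv_single: "weight_deriv d (Poly_Mapping.single g v) = Poly_Mapping.single g (d g * v)"
  by (rule poly_mapping_eqI) (simp add: lookup_weight_deriv lookup_single when_def)

lemma weight_deriv_zero [simp]: "weight_deriv d 0 = 0"
  by (rule poly_mapping_eqI) (simp add: lookup_weight_deriv)

lemma weight_deriv_mult:
  fixes a b :: "'g::ab_group_add \<Rightarrow>\<^sub>0 complex"
  assumes d: "\<And>g h. d (g + h) = d g + d h"
  shows "weight_deriv d (a * b) = weight_deriv d a * b + a * weight_deriv d b"
proof (induction a rule: poly_mapping_additive_induct)
  case (single g v)
  show ?case
  proof (induction b rule: poly_mapping_additive_induct)
    case (single h w)
    then show ?case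
      by (simp add: weight_deriv_single mult_single d single_add[symmetric] algebra_simps)
  qed (simp_all add: weight_deriv_add algebra_simps)
qed (simp_all add: weight_deriv_add algebra_simps)

text \<open>The involution of the group ring that corresponds to the adjoint operator, as
  \<open>Op_star\<close> shows.\<close>

definition star :: "('g::ab_group_add \<Rightarrow>\<^sub>0 complex) \<Rightarrow> ('g \<Rightarrow>\<^sub>0 complex)" where
  "star c = (\<Sum>g\<in>Poly_Mapping.keys c. Poly_Mapping.single (- g) (cnj (Poly_Mapping.lookup c g)))"

definition clinear :: "('a::complex_inner \<Rightarrow> 'b::complex_inner) \<Rightarrow> bool" where
  "clinear f \<longleftrightarrow> (\<forall>x y. f (x + y) = f x + f y) \<and> (\<forall>a x. f (a *\<^sub>C x) = a *\<^sub>C f x)"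

lemma clinearD:
  assumes "clinear f"
  shows "f (x + y) = f x + f y" "f (a *\<^sub>C x) = a *\<^sub>C f x" "f 0 = 0" "f (x - y) = f x - f y" "f (- x) = - f x"
proof -
  show add: "f (x + y) = f x + f y" and sc: "f (a *\<^sub>C x) = a *\<^sub>C f x" for x y a
    using assms by (auto simp: clinear_def)
  show z: "f 0 = 0" using add[of 0 0] by simp
  show m: "f (- x) = - f x" for x using add[of x "- x"] z by (simp add: add_eq_0_iff)
  show "f (x - y) = f x - f y" using add[of x "- y"] m by simp
qed

lemma clinear_sum: "clinear f \<Longrightarrow> f (\<Sum>i\<in>I. g i) = (\<Sum>i\<in>I. f (g i))"
  by (induction I rule: infinite_finite_induct) (auto simp: clinearD)

lemma clinear_comp: "clinear f \<Longrightarrow> clinear g \<Longrightarrow> clinear (\<lambda>x. f (g x))"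
  by (simp add: clinear_def)

text \<open>Applied to translations, to powers of the transition operator, and to both jointly.
  Since the group is abelian, every \<open>Op c\<close> below is normal.\<close>

locale unitary_rep =
  fixes \<rho> :: "'g::ab_group_add \<Rightarrow> 'h::complex_inner \<Rightarrow> 'h"
  assumes linear: "clinear (\<rho> g)"
    and zero: "\<rho> 0 x = x"
    and add: "\<rho> (g + h) x = \<rho> g (\<rho> h x)"
    and inner: "cinner (\<rho> g x) (\<rho> g y) = cinner x y"
begin

lemma norm_preserved: "norm (\<rho> g x) = norm x"
  by (simp add: norm_eq_sqrt_cinner inner)

lemma uminus: "\<rho> g (\<rho> (- g) x) = x" "\<rho> (- g) (\<rho> g x) = x"
  by (simp_all add: add[symmetric] zero)

lemma adjoint: "cinner (\<rho> g x) y = cinner x (\<rho> (- g) y)"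
  using inner[of g x "\<rho> (- g) y"] by (simp add: uminus)

lemma commute: "\<rho> g (\<rho> h x) = \<rho> h (\<rho> g x)"
  by (simp add: add[symmetric] add.commute)

section \<open>The group ring acting by commuting normal operators\<close>

definition Op :: "('g \<Rightarrow>\<^sub>0 complex) \<Rightarrow> 'h \<Rightarrow> 'h" where
  "Op c x = (\<Sum>g\<in>Poly_Mapping.keys c. Poly_Mapping.lookup c g *\<^sub>C \<rho> g x)"

lemma Op_superset:
  "finite K \<Longrightarrow> Poly_Mapping.keys c \<subseteq> K \<Longrightarrow> Op c x = (\<Sum>g\<in>K. Poly_Mapping.lookup c g *\<^sub>C \<rho> g x)"
  unfolding Op_def by (rule sum.mono_neutral_left) (auto simp: in_keys_iff)

lemma Op_single: "Op (Poly_Mapping.single g a) x = a *\<^sub>C \<rho> g x"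
  by (subst Op_superset[of "{g}"]) (auto simp: lookup_single split: if_splits)

lemma Op_zero [simp]: "Op 0 x = 0"
  by (simp add: Op_def)

lemma Op_add: "Op (c + d) x = Op c x + Op d x"
proof -
  let ?K = "Poly_Mapping.keys c \<union> Poly_Mapping.keys d"
  have "Poly_Mapping.keys (c + d) \<subseteq> ?K" by (rule keys_add)
  then show ?thesis
    by (subst (1 2 3) Op_superset[of ?K]) (auto simp: lookup_add scaleC_add_left sum.distrib)
qed

lemma Op_uminus: "Op (- c) x = - Op c x"
  using Op_add[of c "- c" x] by (simp add: add_eq_0_iff)

lemma Op_diff: "Op (c - d) x = Op c x - Op d x"
  using Op_add[of c "- d" x] by (simp add: Op_uminus)

lemma Op_sum: "Op (\<Sum>i\<in>I. f i) x = (\<Sum>i\<in>I. Op (f i) x)"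
  by (induction I rule: infinite_finite_induct) (auto simp: Op_add)

lemma Op_clinear: "clinear (Op c)"
  using linear unfolding clinear_def Op_def
  by (simp add: scaleC_add_right sum.distrib scaleC_sum_right scaleC_scaleC mult.commute)

lemma Op_mult: "Op (c * d) x = Op c (Op d x)"
proof (induction c rule: poly_mapping_additive_induct)
  case (single g v)
  show ?case
  proof (induction d rule: poly_mapping_additive_induct)
    case (single h w)
    show ?case
      by (simp add: mult_single Op_single add clinearD[OF linear] scaleC_scaleC)
  qed (simp_all add: clinearD[OF Op_clinear] distrib_left Op_add)
qed (simp_all add: distrib_right Op_add)

lemma Op_commute: "Op c (Op d x) = Op d (Op c x)"
  by (simp add: Op_mult[symmetric] mult.commute)

lemma Op_norm_bound: "norm (Op c x) \<le> (\<Sum>g\<in>Poly_Mapping.keys c. cmod (Poly_Mapping.lookup c g)) * norm x"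
  unfolding Op_def sum_distrib_right
  by (rule order_trans[OF norm_sum]) (simp add: norm_scaleC norm_preserved)

lemma Op_tendsto: "f \<longlonglongrightarrow> l \<Longrightarrow> (\<lambda>n. Op c (f n)) \<longlonglongrightarrow> Op c l"
proof -
  assume "f \<longlonglongrightarrow> l"
  then have "(\<lambda>n. (\<Sum>g\<in>Poly_Mapping.keys c. cmod (Poly_Mapping.lookup c g)) * norm (f n - l)) \<longlonglongrightarrow> 0"
    by (intro tendsto_mult_right_zero tendsto_norm_zero) (simp add: LIM_zero)
  then have "(\<lambda>n. Op c (f n) - Op c l) \<longlonglongrightarrow> 0"
    by (rule Lim_null_comparison[rotated])
       (simp add: clinearD(4)[OF Op_clinear, symmetric] Op_norm_bound)
  then show ?thesis by (rule LIM_zero_cancel)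
qed

lemma Op_star: "cinner (Op c x) y = cinner x (Op (star c) y)"
proof -
  have "Op (star c) y = (\<Sum>g\<in>Poly_Mapping.keys c. cnj (Poly_Mapping.lookup c g) *\<^sub>C \<rho> (- g) y)"
    by (simp add: star_def Op_sum Op_single)
  then show ?thesis
    unfolding Op_def
    by (simp add: cinner_sum_left cinner_sum_right cinner_scaleC_left cinner_scaleC_right adjoint)
qed

lemma Op_eq_0_of_star_Op:
  assumes "Op (star c) (Op c x) = 0"
  shows "Op c x = 0"
proof -
  have "cinner (Op c x) (Op c x) = 0" using assms by (simp add: Op_star)
  then show ?thesis by (simp add: cinner_self_eq_zero_iff)
qed

text \<open>Normality: \<open>Op c\<close> commutes with its adjoint, so
  \<open>Op (star c) (Op c x)\<close> vanishes.\<close>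

lemma Op_eq_0_of_star: "Op (star c) x = 0 \<Longrightarrow> Op c x = 0"
  by (rule Op_eq_0_of_star_Op) (simp add: Op_commute[of "star c"] clinearD[OF Op_clinear])

text \<open>Normality excludes nilpotent parts: \<open>Op (star (star c))\<close> agrees with
  \<open>Op c\<close> and kills \<open>Op c x\<close>, hence so does \<open>Op (star c)\<close>,
  which makes the norm of \<open>Op c x\<close> zero.\<close>

lemma Op_eq_0_of_Op_Op:
  assumes "Op c (Op c x) = 0"
  shows "Op c x = 0"
proof (rule Op_eq_0_of_star_Op, rule Op_eq_0_of_star)
  have "Op (star (star c)) y = Op c y" for y
  proof -
    have "cinner (Op (star (star c)) y - Op c y) z = 0" for z
    proof -
      have "cinner (Op (star (star c)) y) z = cnj (cinner (Op (star c) z) y)"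
        by (subst cinner_commute) (simp add: Op_star)
      also have "\<dots> = cinner (Op c y) z"
        by (metis Op_star cinner_commute)
      finally show ?thesis by (simp add: cinner_diff_left)
    qed
    then show ?thesis using cinner_eq_0_all by fastforce
  qed
  then show "Op (star (star c)) (Op c x) = 0" by (simp add: assms)
qed

text \<open>Repeated factors \<open>c\<close> are stripped one at a time by
  \<open>Op_eq_0_of_Op_Op\<close>. This is used to reduce an algebraic relation divisible by a power
  of \<open>c\<close>.\<close>

lemma Op_eq_0_of_power: "Op (c ^ Suc n * d) x = 0 \<Longrightarrow> Op (c * d) x = 0"
proof (induction n)
  case (Suc n)
  then have "Op c (Op c (Op (c ^ n * d) x)) = 0" by (simp add: Op_mult[symmetric] mult.assoc)
  then have "Op c (Op (c ^ n * d) x) = 0" by (rule Op_eq_0_of_Op_Op)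
  then have "Op (c ^ Suc n * d) x = 0" by (simp add: Op_mult[symmetric] mult.assoc)
  then show ?case by (rule Suc.IH)
qed simp

lemma kernel_csubspace: "csubspace {x. Op c x = 0}"
  by (auto simp: csubspace_def clinearD[OF Op_clinear])

lemma kernel_complete:
  assumes "complete (UNIV :: 'h set)"
  shows "complete {x. Op c x = 0}"
  unfolding complete_def
proof (intro allI impI, elim conjE)
  fix f assume f: "\<forall>n. f n \<in> {x. Op c x = 0}" "Cauchy f"
  then obtain l where l: "f \<longlonglongrightarrow> l" using assms unfolding complete_def by blast
  have "(\<lambda>n. Op c (f n)) \<longlonglongrightarrow> Op c l" by (rule Op_tendsto[OF l])
  then have "Op c l = 0" using f(1) by (simp add: LIMSEQ_const_iff)
  then show "\<exists>l\<in>{x. Op c x = 0}. f \<longlonglongrightarrow> l" using l by blast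
qed

text \<open>The projection \<open>p\<close> of \<open>y\<close> onto the kernel of
  \<open>Op c\<close> stays in the kernel of \<open>Op d\<close>, because the former is invariant
  under \<open>Op d\<close> and its adjoint. So \<open>p\<close> lies in both kernels and
  vanishes.\<close>

lemma kernels_orthogonal:
  assumes compl: "complete (UNIV :: 'h set)"
    and triv: "\<And>x. Op c x = 0 \<Longrightarrow> Op d x = 0 \<Longrightarrow> x = 0"
    and x: "Op c x = 0" and y: "Op d y = 0"
  shows "cinner x y = 0"
proof -
  obtain p where p: "Op c p = 0" "\<And>s. Op c s = 0 \<Longrightarrow> cinner (y - p) s = 0"
    using orthogonal_decomposition[OF kernel_csubspace kernel_complete[OF compl], of c y]
    unfolding mem_Collect_eq by blast
  have inv: "Op c (Op d s) = 0" "Op c (Op (star d) s) = 0" if "Op c s = 0" for s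
    using that by (simp_all add: Op_commute[of c] clinearD[OF Op_clinear])
  have "Op d p = - Op d (y - p)" using y by (simp add: clinearD[OF Op_clinear])
  then have "cinner (Op d p) (Op d p) = - cinner (y - p) (Op (star d) (Op d p))"
    by (simp add: cinner_minus_left Op_star)
  also have "\<dots> = 0" using p(2) inv p(1) by simp
  finally have "Op d p = 0" by (simp add: cinner_self_eq_zero_iff)
  then have "p = 0" using triv p(1) by blast
  then have "cinner y x = 0" using p(2)[OF x] by simp
  then show ?thesis by (subst cinner_commute) simp
qed

end

section \<open>Translations and characters\<close>

lemma ell2_dominated:
  assumes "f \<in> ell2" "\<And>x. norm (g x) \<le> M * norm (f x)"
  shows "g \<in> ell2"
proof -
  have "(norm (g x))\<^sup>2 \<le> M\<^sup>2 * (norm (f x))\<^sup>2" for x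
    using power_mono[OF assms(2)[of x], of 2] by (simp add: power_mult_distrib)
  moreover have "(\<lambda>x. M\<^sup>2 * (norm (f x))\<^sup>2) summable_on UNIV"
    using assms(1) by (simp add: ell2_def summable_on_cmult_right)
  ultimately show ?thesis
    unfolding ell2_def mem_Collect_eq
    by (metis (no_types, lifting) summable_on_comparison_test zero_le_power2)
qed

lemma norm_l2_dominated:
  assumes "\<And>x. norm (l2_apply g x) \<le> M * norm (l2_apply f x)" "0 \<le> M"
  shows "norm g \<le> M * norm f"
proof (rule norm_l2_leI)
  fix F :: "'a set" assume F: "finite F"
  have "L2_set (\<lambda>x. norm (l2_apply g x)) F \<le> L2_set (\<lambda>x. M * norm (l2_apply f x)) F"
    by (intro L2_set_mono assms) auto
  also have "\<dots> = M * L2_set (\<lambda>x. norm (l2_apply f x)) F"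
    using assms(2) by (simp add: L2_set_right_distrib)
  also have "\<dots> \<le> M * norm f" by (intro mult_left_mono L2_set_le_norm F assms)
  finally show "L2_set (\<lambda>x. norm (l2_apply g x)) F \<le> M * norm f" .
qed

definition shift :: "'x::ab_group_add \<Rightarrow> ('x, 'w::complex_inner) l2 \<Rightarrow> ('x, 'w) l2" where
  "shift z f = Abs_l2 (translate z (l2_apply f))"

lemma bij_minus_const: "bij (\<lambda>x. x - z :: 'x::ab_group_add)"
  by (rule bij_betw_byWitness[of _ "\<lambda>x. x + z"]) auto

lemma translate_ell2: "f \<in> ell2 \<Longrightarrow> translate z f \<in> ell2"
  using summable_on_reindex_bij_betw[OF bij_minus_const, of "\<lambda>x. (norm (f x))\<^sup>2" z]
  by (simp add: ell2_def translate_def)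

lemma shift_apply: "l2_apply (shift z f) x = l2_apply f (x - z)"
  unfolding shift_def by (subst l2_apply_Abs[OF translate_ell2[OF l2_apply]]) (simp add: translate_def)

lemma shift_delta: "shift z (delta y \<phi>) = delta (z + y) \<phi>"
  by (rule l2_eqI) (auto simp: shift_apply delta_apply algebra_simps)

interpretation shift: unitary_rep "shift :: 'x::ab_group_add \<Rightarrow> ('x, 'w::complex_inner) l2 \<Rightarrow> _"
proof
  fix g h :: 'x and f k :: "('x, 'w) l2"
  show "clinear (shift g :: ('x, 'w) l2 \<Rightarrow> _)"
    unfolding clinear_def by (intro conjI allI; rule l2_eqI; simp add: shift_apply)
  show "shift 0 f = f" by (rule l2_eqI) (simp add: shift_apply)
  show "shift (g + h) f = shift g (shift h f)"
    by (rule l2_eqI) (simp add: shift_apply algebra_simps)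
  show "cinner (shift g f) (shift g k) = cinner f k"
    unfolding cinner_l2_def ell2_inner_def shift_apply
    by (rule infsum_reindex_bij_betw[OF bij_minus_const])
qed

lemma fin_supp_shift: "f \<in> fin_supp \<Longrightarrow> shift z f \<in> fin_supp"
  unfolding fin_supp_def mem_Collect_eq
  by (rule finite_subset[of _ "(+) z ` supp f"])
     (auto simp: supp_def shift_apply image_iff intro!: exI[of _ "_ - z"])

section \<open>Multiplication by characters\<close>

definition twist :: "('x \<Rightarrow> complex) \<Rightarrow> ('x, 'w::complex_inner) l2 \<Rightarrow> ('x, 'w) l2" where
  "twist \<kappa> f = Abs_l2 (\<lambda>x. \<kappa> x *\<^sub>C l2_apply f x)"

lemma twist_apply:
  assumes "\<And>x. cmod (\<kappa> x) = 1"
  shows "l2_apply (twist \<kappa> f) x = \<kappa> x *\<^sub>C l2_apply f x"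
proof -
  have "(\<lambda>x. \<kappa> x *\<^sub>C l2_apply f x) \<in> ell2"
    by (rule ell2_dominated[OF l2_apply[of f], of _ 1]) (simp add: norm_scaleC assms)
  then show ?thesis by (simp add: twist_def)
qed

lemma norm_twist:
  assumes "\<And>x. cmod (\<kappa> x) = 1"
  shows "norm (twist \<kappa> f) = norm f"
  by (simp add: norm_l2_def twist_apply[OF assms] norm_scaleC assms)

text \<open>Multiplication by a character \<open>\<kappa>\<close> conjugates translation by
  \<open>y\<close> into \<open>\<kappa> y\<close> times that translation.\<close>

lemma Op_twist:
  fixes \<kappa> :: "'x::ab_group_add \<Rightarrow> complex"
  assumes u: "\<And>x. cmod (\<kappa> x) = 1" and m: "\<And>x y. \<kappa> (x + y) = \<kappa> x * \<kappa> y"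
  shows "shift.Op (weight_deriv \<kappa> a) (twist \<kappa> f) = twist \<kappa> (shift.Op a f)"
proof (rule l2_eqI)
  fix x
  have sub: "Poly_Mapping.keys (weight_deriv \<kappa> a) \<subseteq> Poly_Mapping.keys a"
    by (auto simp: in_keys_iff lookup_weight_deriv)
  have "l2_apply (shift.Op (weight_deriv \<kappa> a) (twist \<kappa> f)) x
      = (\<Sum>y\<in>Poly_Mapping.keys a. (\<kappa> y * Poly_Mapping.lookup a y * \<kappa> (x - y)) *\<^sub>C l2_apply f (x - y))"
    by (simp add: shift.Op_superset[OF finite_keys sub] l2_apply_sum lookup_weight_deriv
        shift_apply twist_apply[OF u] scaleC_scaleC)
  also have "\<dots> = (\<Sum>y\<in>Poly_Mapping.keys a. (\<kappa> x * Poly_Mapping.lookup a y) *\<^sub>C l2_apply f (x - y))"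
  proof (rule sum.cong[OF refl])
    fix y
    have "\<kappa> x = \<kappa> y * \<kappa> (x - y)" by (simp add: m[symmetric])
    then show "(\<kappa> y * Poly_Mapping.lookup a y * \<kappa> (x - y)) *\<^sub>C l2_apply f (x - y)
        = (\<kappa> x * Poly_Mapping.lookup a y) *\<^sub>C l2_apply f (x - y)"
      by (simp add: mult_ac)
  qed
  also have "\<dots> = l2_apply (twist \<kappa> (shift.Op a f)) x"
    by (simp add: twist_apply[OF u] shift.Op_def l2_apply_sum shift_apply scaleC_sum_right scaleC_scaleC)
  finally show "l2_apply (shift.Op (weight_deriv \<kappa> a) (twist \<kappa> f)) x = l2_apply (twist \<kappa> (shift.Op a f)) x" .
qed

lemma (in unitary_rep) Op_weight_deriv_const: "Op (weight_deriv (\<lambda>_. k) c) x = k *\<^sub>C Op c x"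
proof -
  have "Poly_Mapping.keys (weight_deriv (\<lambda>_. k) c) \<subseteq> Poly_Mapping.keys c"
    by (auto simp: in_keys_iff lookup_weight_deriv)
  from Op_superset[OF finite_keys this] show ?thesis
    by (simp add: lookup_weight_deriv Op_def scaleC_sum_right scaleC_scaleC)
qed

lemma cis_neq_1: "t \<noteq> 0 \<Longrightarrow> \<bar>t\<bar> < 1 \<Longrightarrow> cis t \<noteq> 1"
proof
  assume t: "t \<noteq> 0" "\<bar>t\<bar> < 1" and "cis t = 1"
  then have "sin t = 0" by (simp add: complex_eq_iff)
  moreover have "sin \<bar>t\<bar> > 0" using t pi_ge_two by (intro sin_gt_zero) auto
  ultimately show False by (auto simp: abs_if split: if_splits)
qed

lemma complete_l2: "complete (UNIV :: ('x, 'w::fin_dim_complex_hilbert) l2 set)"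
  using complete_UNIV .

text \<open>If \<open>a\<close> annihilates \<open>f\<close> then the twist of \<open>a\<close> by a character annihilates the twist of \<open>f\<close>. For
  generic characters the twists of \<open>a\<close> have no common kernel (a combination of two of them has
  smaller support), so the twists of \<open>f\<close> are pairwise orthogonal; as they all have the same
  pointwise norm, arbitrarily many of them force \<open>f = 0\<close>.\<close>

lemma shift_Op_injective:
  fixes a :: "(int ^ 'd::finite) \<Rightarrow>\<^sub>0 complex" and f :: "(int ^ 'd, 'w::fin_dim_complex_hilbert) l2"
  assumes "a \<noteq> 0" "shift.Op a f = 0"
  shows "f = 0"
  using assms
proof (induction "card (Poly_Mapping.keys a)" arbitrary: a f rule: less_induct)
  case less
  obtain y0 where y0: "y0 \<in> Poly_Mapping.keys a"
    using less.prems(1) by (metis all_not_in_conv keys_eq_empty)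
  show ?case
  proof (cases "Poly_Mapping.keys a = {y0}")
    case True
    then have "Poly_Mapping.lookup a y0 *\<^sub>C shift y0 f = 0"
      using less.prems(2) by (simp add: shift.Op_def)
    then have "shift y0 f = 0" using y0 by (simp add: scaleC_eq_0_iff in_keys_iff)
    then show ?thesis using shift.norm_preserved[of y0 f] by simp
  next
    case False
    then obtain y1 where y1: "y1 \<in> Poly_Mapping.keys a" "y1 \<noteq> y0" using y0 by blast
    then obtain j where j: "y1 $ j \<noteq> y0 $ j" by (auto simp: vec_eq_iff)
    \<comment> \<open>The bound holds for every \<open>K\<close>, so letting \<open>K\<close> grow
      forces \<open>f\<close> to vanish at \<open>x\<close>.\<close>
    have key: "real K * (norm (l2_apply f x))\<^sup>2 \<le> (norm f)\<^sup>2" if K: "K > 0" for K x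
    proof -
      define D where "D = real_of_int (y1 $ j - y0 $ j)"
      have D: "D \<noteq> 0" using j by (simp add: D_def)
      \<comment> \<open>With these frequencies the ratio of \<open>\<kappa> r\<close> and
        \<open>\<kappa> s\<close>, compared between \<open>y1\<close> and \<open>y0\<close>, is
        \<open>cis ((r - s) / K)\<close>, whose angle is nonzero and smaller than 1 in
        modulus.\<close>
      define \<kappa> where "\<kappa> r z = cis (real r / (real K * D) * real_of_int (z $ j))" for r and z :: "int ^ 'd"
      have u: "cmod (\<kappa> r z) = 1" for r z by (simp add: \<kappa>_def)
      have nz: "\<kappa> r z \<noteq> 0" for r z by (simp add: \<kappa>_def)
      have m: "\<kappa> r (y + z) = \<kappa> r y * \<kappa> r z" for r y z
        by (simp add: \<kappa>_def cis_mult algebra_simps)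
      have sep: "\<kappa> r y1 * \<kappa> s y0 \<noteq> \<kappa> r y0 * \<kappa> s y1" if "r < K" "s < K" "r \<noteq> s" for r s
      proof
        assume eq: "\<kappa> r y1 * \<kappa> s y0 = \<kappa> r y0 * \<kappa> s y1"
        define P where "P n = real n / (real K * D)" for n
        have "(real r - real s) / real K = (P r - P s) * D"
          using D K by (simp add: P_def field_simps)
        also have "\<dots> = P r * y1 $ j + P s * y0 $ j - (P r * y0 $ j + P s * y1 $ j)"
          by (simp add: D_def algebra_simps)
        finally have "cis ((real r - real s) / real K) = \<kappa> r y1 * \<kappa> s y0 / (\<kappa> r y0 * \<kappa> s y1)"
          by (simp add: \<kappa>_def P_def[symmetric] cis_mult cis_divide)
        also have "\<dots> = 1" using eq nz by simp
        finally have "cis ((real r - real s) / real K) = 1" .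
        moreover have "\<bar>(real r - real s) / real K\<bar> < 1" using that K by (simp add: field_simps abs_if)
        moreover have "(real r - real s) / real K \<noteq> 0" using that K by simp
        ultimately show False using cis_neq_1 by blast
      qed
      define F where "F r = twist (\<kappa> r) f" for r
      define A where "A r = weight_deriv (\<kappa> r) a" for r
      have AF: "shift.Op (A r) (F r) = 0" for r
        unfolding A_def F_def Op_twist[OF u m] less.prems(2)
        by (rule l2_eqI) (simp add: twist_apply[OF u])
      have orth: "cinner (F r) (F s) = 0" if rs: "r < K" "s < K" "r \<noteq> s" for r s
      proof (rule shift.kernels_orthogonal[OF complete_l2 _ AF AF])
        fix h :: "(int ^ 'd, 'w) l2"
        assume h: "shift.Op (A r) h = 0" "shift.Op (A s) h = 0"
        \<comment> \<open>This factor cancels the coefficient at \<open>y0\<close> in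
          \<open>b\<close>, while \<open>sep\<close> keeps the one at \<open>y1\<close>; the
          induction hypothesis then applies to \<open>b\<close>.\<close>
        define k where "k = \<kappa> r y0 / \<kappa> s y0"
        define b where "b = A r - weight_deriv (\<lambda>_. k) (A s)"
        have lb: "Poly_Mapping.lookup b y = (\<kappa> r y - k * \<kappa> s y) * Poly_Mapping.lookup a y" for y
          by (simp add: b_def A_def lookup_minus lookup_weight_deriv algebra_simps)
        have "Poly_Mapping.keys b \<subseteq> Poly_Mapping.keys a - {y0}"
          using nz by (auto simp: in_keys_iff lb k_def)
        then have "card (Poly_Mapping.keys b) < card (Poly_Mapping.keys a)"
          using y0 by (meson card_Diff1_less card_mono finite_Diff finite_keys le_less_trans)
        moreover have "Poly_Mapping.lookup b y1 \<noteq> 0"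
          using y1 sep[OF rs] nz[of s y0] by (simp add: lb k_def in_keys_iff field_simps)
        then have "b \<noteq> 0" by auto
        moreover have "shift.Op b h = 0"
          by (simp add: b_def shift.Op_diff shift.Op_weight_deriv_const h)
        ultimately show "h = 0" using less.hyps by blast
      qed
      \<comment> \<open>The coefficients undo the twists at \<open>x\<close>, so the value at
        \<open>x\<close> is \<open>K\<close> times that of \<open>f\<close>, while by orthogonality
        the squared norm is only \<open>K\<close> times that of \<open>f\<close>.\<close>
      define g where "g = (\<Sum>r<K. cnj (\<kappa> r x) *\<^sub>C F r)"
      have "cinner g g = (\<Sum>r<K. \<Sum>s<K. cnj (\<kappa> r x) * (\<kappa> s x * cinner (F r) (F s)))"
        by (simp add: g_def cinner_sum_left cinner_sum_right cinner_scaleC_left cinner_scaleC_right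
            sum_distrib_left) (subst sum.swap, simp add: mult_ac)
      also have "\<dots> = (\<Sum>r<K. \<Sum>s<K. if s = r then complex_of_real ((norm f)\<^sup>2) else 0)"
      proof (intro sum.cong refl)
        fix r s assume rs: "r \<in> {..<K}" "s \<in> {..<K}"
        have "cnj (\<kappa> r x) * \<kappa> r x = 1"
          using complex_norm_square[of "\<kappa> r x"] u[of r x] by (simp add: mult.commute)
        then show "cnj (\<kappa> r x) * (\<kappa> s x * cinner (F r) (F s)) = (if s = r then complex_of_real ((norm f)\<^sup>2) else 0)"
          using orth[of r s] rs by (auto simp: mult.assoc[symmetric] cinner_self F_def norm_twist[OF u])
      qed
      also have "\<dots> = complex_of_real (real K * (norm f)\<^sup>2)" by simp
      finally have "(norm g)\<^sup>2 = real K * (norm f)\<^sup>2"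
        unfolding cinner_self of_real_eq_iff .
      moreover have "l2_apply g x = real K *\<^sub>R l2_apply f x"
      proof -
        have "cnj (\<kappa> r x) * \<kappa> r x = 1" for r
          using complex_norm_square[of "\<kappa> r x"] u[of r x] by (simp add: mult.commute)
        then have "l2_apply g x = (\<Sum>r<K. l2_apply f x)"
          by (simp add: g_def l2_apply_sum F_def twist_apply[OF u] scaleC_scaleC scaleC_one)
        then show ?thesis by (simp add: sum_constant_scaleR)
      qed
      then have "real K * norm (l2_apply f x) \<le> norm g"
        using norm_apply_le[of g x] by simp
      then have "(real K * norm (l2_apply f x))\<^sup>2 \<le> (norm g)\<^sup>2" by (intro power_mono) auto
      ultimately have "real K * (real K * (norm (l2_apply f x))\<^sup>2) \<le> real K * (norm f)\<^sup>2"
        by (simp add: power_mult_distrib power2_eq_square mult_ac)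
      then show ?thesis using K by simp
    qed
    show ?thesis
    proof (rule l2_eqI)
      fix x
      show "l2_apply f x = l2_apply 0 x"
      proof (rule ccontr)
        assume "l2_apply f x \<noteq> l2_apply 0 x"
        then have "(norm (l2_apply f x))\<^sup>2 > 0" by simp
        then obtain n where n: "(norm f)\<^sup>2 < real n * (norm (l2_apply f x))\<^sup>2"
          using reals_Archimedean3 by blast
        then have "n > 0" by (cases n) auto
        then show False using key[of n x] n by simp
      qed
    qed
  qed
qed

section \<open>The position operator\<close>

text \<open>Meant on \<open>fin_supp\<close> only: multiplication by a coordinate can destroy square
  summability, and for infinite support the sum defaults to 0.\<close>

definition position :: "'d \<Rightarrow> (int ^ 'd, 'w::complex_inner) l2 \<Rightarrow> (int ^ 'd, 'w) l2" where
  "position j f = (\<Sum>y\<in>supp f. delta y (of_int (y $ j) *\<^sub>C l2_apply f y))"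

lemma position_apply:
  assumes "f \<in> fin_supp"
  shows "l2_apply (position j f) x = of_int (x $ j) *\<^sub>C l2_apply f x"
proof -
  have "finite (supp f)" using assms by (simp add: fin_supp_def)
  then have "(\<Sum>y\<in>supp f. if x = y then of_int (y $ j) *\<^sub>C l2_apply f y else 0) = of_int (x $ j) *\<^sub>C l2_apply f x"
    by (simp add: supp_def)
  then show ?thesis by (simp add: position_def l2_apply_sum delta_apply)
qed

lemma fin_supp_position [simp]: "position j f \<in> fin_supp"
  unfolding position_def by (rule fin_supp_sum) simp

lemma position_add: "f \<in> fin_supp \<Longrightarrow> g \<in> fin_supp \<Longrightarrow> position j (f + g) = position j f + position j g"
  by (rule l2_eqI) (simp add: position_apply fin_supp_add scaleC_add_right)

lemma position_scaleC: "f \<in> fin_supp \<Longrightarrow> position j (a *\<^sub>C f) = a *\<^sub>C position j f"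
  by (rule l2_eqI) (simp add: position_apply fin_supp_scaleC scaleC_scaleC mult.commute)

lemma position_0: "position j 0 = 0"
  by (rule l2_eqI) (simp add: position_apply)

lemma position_sum:
  "finite I \<Longrightarrow> (\<And>i. i \<in> I \<Longrightarrow> f i \<in> fin_supp) \<Longrightarrow> position j (\<Sum>i\<in>I. f i) = (\<Sum>i\<in>I. position j (f i))"
  by (induction I rule: finite_induct) (auto simp: position_add fin_supp_sum position_0)

lemma position_shift:
  "f \<in> fin_supp \<Longrightarrow> position j (shift z f) = shift z (position j f) + of_int (z $ j) *\<^sub>C shift z f"
  by (rule l2_eqI)
     (simp add: position_apply fin_supp_shift shift_apply scaleC_add_left[symmetric])

lemma position_symmetric:
  assumes "f \<in> fin_supp" "g \<in> fin_supp"
  shows "cinner (position j f) g = cinner f (position j g)"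
  unfolding cinner_l2_def ell2_inner_def
  by (rule infsum_cong) (simp add: position_apply assms cinner_scaleC_left cinner_scaleC_right)

text \<open>The kernel of \<open>[X, G]\<close> is that of \<open>G\<close> multiplied by the displacement, which is bounded
  because \<open>G\<close> has finite range.\<close>

lemma commutator_position_bounded:
  fixes G :: "(int ^ 'd::finite, 'w::fin_dim_complex_hilbert) l2 \<Rightarrow> (int ^ 'd, 'w) l2"
  assumes lin: "clinear G"
    and shift: "\<And>z h. G (shift z h) = shift z (G h)"
    and norm: "\<And>h. norm (G h) = norm h"
    and fin: "\<And>h. h \<in> fin_supp \<Longrightarrow> G h \<in> fin_supp"
  shows "\<exists>C\<ge>0. \<forall>h\<in>fin_supp. norm (position j (G h) - G (position j h)) \<le> C * norm h"
proof -
  obtain B :: "'w set" where B: "finite B" "\<And>x. \<exists>c. x = (\<Sum>b\<in>B. c b *\<^sub>C b)"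
    using finite_spanning_set by blast
  \<comment> \<open>As \<open>B\<close> is finite and spanning, one finite set of displacements
    serves for all values in \<open>'w\<close>.\<close>
  define S where "S = (\<Union>b\<in>B. supp (G (delta 0 b)))"
  have S: "finite S" using B(1) fin[OF fin_supp_delta] by (auto simp: S_def fin_supp_def)
  \<comment> \<open>The matrix entry of \<open>G\<close> for displacement \<open>s\<close>; by
    translation invariance it is the same at every site.\<close>
  define M where "M s \<phi> = l2_apply (G (delta 0 \<phi>)) s" for s \<phi>
  have Madd: "M s (\<phi> + \<psi>) = M s \<phi> + M s \<psi>" and Msc: "M s (a *\<^sub>C \<phi>) = a *\<^sub>C M s \<phi>" for s a \<phi> \<psi>
    by (simp_all add: M_def delta_add delta_scaleC clinearD[OF lin])
  have Mlin: "clinear (M s)" for s by (simp add: clinear_def Madd Msc)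
  have M0: "M s \<phi> = 0" if "s \<notin> S" for s \<phi>
  proof -
    obtain c where c: "\<phi> = (\<Sum>b\<in>B. c b *\<^sub>C b)" using B(2) by blast
    have "M s b = 0" if "b \<in> B" for b using that \<open>s \<notin> S\<close> by (auto simp: S_def M_def supp_def)
    then show ?thesis unfolding c by (simp add: clinear_sum[OF Mlin] Msc)
  qed
  have Mn: "norm (M s \<phi>) \<le> norm \<phi>" for s \<phi>
    using norm_apply_le[of "G (delta 0 \<phi>)" s] by (simp add: M_def norm)
  have Gd: "l2_apply (G (delta y \<phi>)) x = M (x - y) \<phi>" for x y \<phi>
    using shift[of y "delta 0 \<phi>"] by (simp add: shift_delta M_def shift_apply)
  have bound: "norm (position j (G h) - G (position j h)) \<le> (\<Sum>s\<in>S. \<bar>real_of_int (s $ j)\<bar>) * norm h"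
    if h: "h \<in> fin_supp" for h
  proof -
    have fs: "finite (supp h)" using h by (simp add: fin_supp_def)
    \<comment> \<open>The part of \<open>G h\<close> that moves by \<open>s\<close>. The commutator
      is the sum of these parts weighted with \<open>s $ j\<close>.\<close>
    define D where "D s = Abs_l2 (\<lambda>x. M s (l2_apply h (x - s)))" for s
    have "(\<lambda>x. M s (l2_apply h (x - s))) \<in> ell2" for s
      by (rule ell2_dominated[OF l2_apply[of "shift s h"], of _ 1]) (simp add: shift_apply Mn)
    then have D: "l2_apply (D s) x = M s (l2_apply h (x - s))" for s x by (simp add: D_def)
    have Dn: "norm (D s) \<le> norm h" for s
      using norm_l2_dominated[of "D s" 1 "shift s h"] by (simp add: D Mn shift_apply shift.norm_preserved)
    have "position j (G h) - G (position j h) = (\<Sum>s\<in>S. of_int (s $ j) *\<^sub>C D s)"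
    proof (rule l2_eqI)
      fix x
      let ?t = "\<lambda>s. of_int (s $ j) *\<^sub>C M s (l2_apply h (x - s))"
      let ?T = "(\<lambda>y. x - y) ` supp h"
      have 1: "l2_apply (G h) x = (\<Sum>y\<in>supp h. M (x - y) (l2_apply h y))"
        by (subst fin_supp_expand[OF h]) (simp add: clinear_sum[OF lin] l2_apply_sum Gd)
      have 2: "l2_apply (G (position j h)) x = (\<Sum>y\<in>supp h. of_int (y $ j) *\<^sub>C M (x - y) (l2_apply h y))"
        unfolding position_def by (simp add: clinear_sum[OF lin] l2_apply_sum Gd Msc)
      have "l2_apply (position j (G h) - G (position j h)) x
          = (\<Sum>y\<in>supp h. of_int ((x - y) $ j) *\<^sub>C M (x - y) (l2_apply h y))"
        by (simp add: position_apply[OF fin[OF h]] 1 2 scaleC_sum_right scaleC_diff_left sum_subtractf)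
      also have "\<dots> = sum ?t ?T"
        by (subst sum.reindex) (auto simp: inj_on_def)
      also have "\<dots> = sum ?t (S \<union> ?T)"
      proof (rule sum.mono_neutral_left)
        show "\<forall>s\<in>S \<union> ?T - ?T. ?t s = 0"
        proof
          fix s assume "s \<in> S \<union> ?T - ?T"
          then have "x - s \<notin> supp h" by (metis Diff_iff diff_diff_eq2 add_diff_cancel_left' image_eqI)
          then show "?t s = 0" by (simp add: supp_def clinearD[OF Mlin])
        qed
      qed (auto simp: S fs)
      also have "\<dots> = sum ?t S"
      proof (rule sum.mono_neutral_right)
        show "\<forall>s\<in>S \<union> ?T - S. ?t s = 0" by (simp add: M0)
      qed (auto simp: S fs)
      also have "\<dots> = l2_apply (\<Sum>s\<in>S. of_int (s $ j) *\<^sub>C D s) x"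
        by (simp add: l2_apply_sum D)
      finally show "l2_apply (position j (G h) - G (position j h)) x = l2_apply (\<Sum>s\<in>S. of_int (s $ j) *\<^sub>C D s) x" .
    qed
    then show ?thesis
      by (simp add: sum_distrib_right)
         (rule order_trans[OF norm_sum], rule sum_mono, simp add: norm_scaleC Dn mult_left_mono)
  qed
  then show ?thesis by (intro exI[of _ "\<Sum>s\<in>S. \<bar>real_of_int (s $ j)\<bar>"]) (auto intro: sum_nonneg)
qed

section \<open>Periodic unitary transition operators\<close>

text \<open>Preservation of \<open>fin_supp\<close> stands in for finite range: with translation
  invariance and finite dimension it yields a uniform range. The inverse \<open>V\<close> supplies
  negative powers.\<close>

locale periodic_transition =
  fixes U V :: "(int ^ 'd::finite, 'w::fin_dim_complex_hilbert) l2 \<Rightarrow> (int ^ 'd, 'w) l2"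
  assumes U_linear: "clinear U"
    and U_inner: "cinner (U f) (U g) = cinner f g"
    and UV: "U (V f) = f" and VU: "V (U f) = f"
    and U_shift: "U (shift z f) = shift z (U f)"
    and U_fin: "f \<in> fin_supp \<Longrightarrow> U f \<in> fin_supp"
    and V_fin: "f \<in> fin_supp \<Longrightarrow> V f \<in> fin_supp"
begin

lemma V_linear: "clinear V"
proof -
  have "V (f + g) = V (U (V f + V g))" "V (a *\<^sub>C f) = V (U (a *\<^sub>C V f))" for a f g
    by (simp_all add: clinearD[OF U_linear] UV)
  then show ?thesis by (simp add: clinear_def VU)
qed

lemma V_shift: "V (shift z f) = shift z (V f)"
  by (metis U_shift UV VU)

definition Upow :: "int \<Rightarrow> (int ^ 'd, 'w) l2 \<Rightarrow> (int ^ 'd, 'w) l2" where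
  "Upow k = (if 0 \<le> k then U ^^ nat k else V ^^ nat (- k))"

lemma Upow_0 [simp]: "Upow 0 f = f"
  by (simp add: Upow_def)

lemma Upow_of_nat: "Upow (int n) f = (U ^^ n) f"
  by (simp add: Upow_def)

lemma Upow_Suc: "Upow (k + 1) f = U (Upow k f)"
proof (cases "0 \<le> k")
  case True
  then show ?thesis by (simp add: Upow_def nat_add_distrib)
next
  case False
  then have "nat (- k) = Suc (nat (- (k + 1)))" by simp
  then have "Upow k f = V (Upow (k + 1) f)" using False by (cases "k = -1") (simp_all add: Upow_def)
  then show ?thesis by (simp add: UV)
qed

lemma Upow_pred: "Upow (k - 1) f = V (Upow k f)"
  using Upow_Suc[of "k - 1" f] by (simp add: VU)

lemma Upow_add: "Upow (k + l) f = Upow k (Upow l f)"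
proof (induction k rule: int_induct[of _ 0])
  case (step1 i)
  have "i + 1 + l = i + l + 1" by simp
  then show ?case using step1 by (simp only: Upow_Suc)
next
  case (step2 i)
  have "i - 1 + l = i + l - 1" by simp
  then show ?case using step2 by (simp only: Upow_pred)
qed simp

lemma Upow_linear: "clinear (Upow k)"
proof (induction k rule: int_induct[of _ 0])
  case base
  then show ?case by (simp add: clinear_def)
next
  case (step1 i)
  then show ?case using U_linear by (simp add: clinear_def Upow_Suc)
next
  case (step2 i)
  then show ?case using V_linear by (simp add: clinear_def Upow_pred)
qed

lemma Upow_shift: "Upow k (shift z f) = shift z (Upow k f)"
  by (induction k rule: int_induct[of _ 0]) (simp_all add: Upow_Suc Upow_pred U_shift V_shift)

lemma Upow_inner: "cinner (Upow k f) (Upow k g) = cinner f g"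
proof (induction k rule: int_induct[of _ 0])
  case (step2 i)
  then show ?case by (metis Upow_pred U_inner UV)
qed (simp_all add: Upow_Suc U_inner)

lemma Upow_fin: "f \<in> fin_supp \<Longrightarrow> Upow k f \<in> fin_supp"
  by (induction k rule: int_induct[of _ 0]) (simp_all add: Upow_Suc Upow_pred U_fin V_fin)

text \<open>Time and space translations acting together. In this locale the unqualified
  \<open>Op\<close> belongs to this action, \<open>shift.Op\<close> to translations alone, and the
  prefix \<open>P\<close> to powers of \<open>U\<close> alone.\<close>

definition rep :: "int \<times> (int ^ 'd) \<Rightarrow> (int ^ 'd, 'w) l2 \<Rightarrow> (int ^ 'd, 'w) l2" where
  "rep g f = Upow (fst g) (shift (snd g) f)"

sublocale P: unitary_rep Upow
  by standard (simp_all add: Upow_linear Upow_add Upow_inner)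

sublocale unitary_rep rep
proof
  show "clinear (rep g)" for g
    unfolding rep_def using Upow_linear shift.linear by (rule clinear_comp)
qed (simp_all add: rep_def Upow_add Upow_inner Upow_shift shift.inner shift.add shift.zero)

lemma rep_fin: "f \<in> fin_supp \<Longrightarrow> rep g f \<in> fin_supp"
  by (simp add: rep_def Upow_fin fin_supp_shift)

lemma Op_fin: "f \<in> fin_supp \<Longrightarrow> Op c f \<in> fin_supp"
  unfolding Op_def by (intro fin_supp_sum fin_supp_scaleC rep_fin)

section \<open>Position in the Heisenberg picture, at integer times\<close>

definition evol :: "'d \<Rightarrow> int \<Rightarrow> (int ^ 'd, 'w) l2 \<Rightarrow> (int ^ 'd, 'w) l2" where
  "evol j i f = Upow (- i) (position j (Upow i f))"

text \<open>The increment is the commutator of \<open>position j\<close> with \<open>Upow k\<close>,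
  evaluated at \<open>Upow n f\<close> and transported by a unitary. Hence the constant depends on
  \<open>k\<close> but not on the time \<open>n\<close>.\<close>

lemma evol_increment_bounded:
  "\<exists>C\<ge>0. \<forall>n. \<forall>f\<in>fin_supp. norm (evol j (n + k) f - evol j n f) \<le> C * norm f"
proof -
  obtain C where C: "C \<ge> 0"
    "\<And>h. h \<in> fin_supp \<Longrightarrow> norm (position j (Upow k h) - Upow k (position j h)) \<le> C * norm h"
    using commutator_position_bounded[OF Upow_linear Upow_shift P.norm_preserved Upow_fin] by metis
  have "norm (evol j (n + k) f - evol j n f) \<le> C * norm f" if "f \<in> fin_supp" for n f
  proof -
    have "evol j (n + k) f - evol j n f = Upow (- (n + k)) (position j (Upow k (Upow n f)) - Upow k (position j (Upow n f)))"
      by (simp add: evol_def clinearD[OF Upow_linear] Upow_add[symmetric] add.commute)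
    then show ?thesis
      using C(2)[OF Upow_fin[OF that], of n] by (simp add: P.norm_preserved)
  qed
  then show ?thesis using C(1) by blast
qed

text \<open>A sum of increments of lag \<open>k\<close> consists of \<open>k\<close> telescoping
  sums up to boundary terms, and these are increments of bounded lag. So the error is uniform in
  \<open>n\<close>.\<close>

lemma evol_sum_bounded:
  "\<exists>C\<ge>0. \<forall>n::nat. \<forall>f\<in>fin_supp. norm ((\<Sum>i<n. evol j (int i + k) f - evol j (int i) f)
      - of_int k *\<^sub>C (evol j (int n) f - evol j 0 f)) \<le> C * norm f"
  (is "\<exists>C\<ge>0. \<forall>n. \<forall>f\<in>fin_supp. norm (?E k n f) \<le> C * norm f")
proof -
  \<comment> \<open>Raising the lag by one adds a telescoping sum. Relative to the subtracted
    multiple only two increments of lag \<open>k\<close> remain, at times \<open>n\<close> and 0.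
    Read backwards, this also handles negative lags.\<close>
  have step: "?E (k + 1) n f = ?E k n f + ((evol j (int n + k) f - evol j (int n) f) - (evol j (0 + k) f - evol j 0 f))"
    for k and n :: nat and f
  proof -
    have "(\<Sum>i<n. evol j (int i + (k + 1)) f - evol j (int i) f)
        = (\<Sum>i<n. evol j (int i + k) f - evol j (int i) f) + (\<Sum>i<n. evol j (int (Suc i) + k) f - evol j (int i + k) f)"
      by (simp add: sum.distrib[symmetric] add_ac)
    also have "(\<Sum>i<n. evol j (int (Suc i) + k) f - evol j (int i + k) f) = evol j (int n + k) f - evol j (0 + k) f"
      using sum_lessThan_telescope[of "\<lambda>i. evol j (int i + k) f" n] by simp
    finally show ?thesis by (simp add: scaleC_add_left scaleC_one algebra_simps)
  qed
  obtain K where K: "\<And>k. K k \<ge> 0"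
    "\<And>k n f. f \<in> fin_supp \<Longrightarrow> norm (evol j (n + k) f - evol j n f) \<le> K k * norm f"
    using evol_increment_bounded by metis
  have nrm: "norm ((evol j (int n + k) f - evol j (int n) f) - (evol j (0 + k) f - evol j 0 f)) \<le> 2 * K k * norm f"
    if "f \<in> fin_supp" for k n f
    using norm_triangle_ineq4[of "evol j (int n + k) f - evol j (int n) f" "evol j (0 + k) f - evol j 0 f"]
      K(2)[OF that, of "int n" k] K(2)[OF that, of 0 k] by linarith
  show ?thesis
  proof (induction k rule: int_induct[of _ 0])
    case base
    show ?case by (intro exI[of _ 0]) simp
  next
    case (step1 i)
    then obtain C where C: "C \<ge> 0" "\<And>n f. f \<in> fin_supp \<Longrightarrow> norm (?E i n f) \<le> C * norm f" by blast
    have "norm (?E (i + 1) n f) \<le> (C + 2 * K i) * norm f" if "f \<in> fin_supp" for n f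
      unfolding step
      by (rule order_trans[OF norm_triangle_ineq])
         (use C(2)[OF that] nrm[OF that] in \<open>simp add: distrib_right add_mono\<close>)
    then show ?case using C(1) K(1)[of i] by (intro exI[of _ "C + 2 * K i"]) auto
  next
    case (step2 i)
    then obtain C where C: "C \<ge> 0" "\<And>n f. f \<in> fin_supp \<Longrightarrow> norm (?E i n f) \<le> C * norm f" by blast
    have "norm (?E (i - 1) n f) \<le> (C + 2 * K (i - 1)) * norm f" if "f \<in> fin_supp" for n f
    proof -
      have "?E (i - 1) n f = ?E i n f - ((evol j (int n + (i - 1)) f - evol j (int n) f) - (evol j (0 + (i - 1)) f - evol j 0 f))"
        using step[where k = "i - 1" and n = n and f = f] by (simp only: diff_add_cancel) simp
      then show ?thesis
        using norm_triangle_ineq4[of "?E i n f" "(evol j (int n + (i - 1)) f - evol j (int n) f) - (evol j (0 + (i - 1)) f - evol j 0 f)"]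
          C(2)[OF that, where n = n] nrm[OF that, where n = n and k = "i - 1"] by (simp only: distrib_right)
    qed
    then show ?case using C(1) K(1)[of "i - 1"] by (intro exI[of _ "C + 2 * K (i - 1)"]) auto
  qed
qed

text \<open>The evolved position at time \<open>n\<close> has no bound uniform in \<open>n\<close>
  here, but \<open>Upow (n + k)\<close> turns it into \<open>Upow k (position j (Upow n f))\<close>,
  and the position operator can be moved onto the fixed test vector.\<close>

lemma evol_sum_weakly_bounded:
  assumes f: "f \<in> fin_supp" and \<phi>: "\<phi> \<in> fin_supp"
  shows "\<exists>B. \<forall>n::nat. cmod (cinner (Upow (int n) (Upow k (\<Sum>i<n. evol j (int i + k) f - evol j (int i) f))) \<phi>) \<le> B"
proof -
  obtain C where C: "\<And>n::nat. norm ((\<Sum>i<n. evol j (int i + k) f - evol j (int i) f)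
      - of_int k *\<^sub>C (evol j (int n) f - evol j 0 f)) \<le> C * norm f"
    using evol_sum_bounded[of j k] f by blast
  define a where "a = norm f * norm (position j (Upow (- k) \<phi>))"
  define b where "b = norm (position j f) * norm \<phi>"
  have "cmod (cinner (Upow (int n) (Upow k (\<Sum>i<n. evol j (int i + k) f - evol j (int i) f))) \<phi>)
      \<le> C * norm f * norm \<phi> + \<bar>real_of_int k\<bar> * (a + b)" for n :: nat
  proof -
    define e where "e = (\<Sum>i<n. evol j (int i + k) f - evol j (int i) f) - of_int k *\<^sub>C (evol j (int n) f - evol j 0 f)"
    have split: "Upow (int n) (Upow k (\<Sum>i<n. evol j (int i + k) f - evol j (int i) f))
        = Upow (int n + k) e + of_int k *\<^sub>C (Upow (int n + k) (evol j (int n) f) - Upow (int n + k) (evol j 0 f))"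
      by (simp add: e_def Upow_add clinearD[OF Upow_linear])
    have "cmod (cinner (Upow (int n + k) e) \<phi>) \<le> C * norm f * norm \<phi>"
      using cauchy_schwarz[of "Upow (int n + k) e" \<phi>] C[of n, folded e_def]
      by (simp add: P.norm_preserved) (meson mult_right_mono norm_ge_zero order_trans)
    moreover have "cmod (cinner (Upow (int n + k) (evol j (int n) f)) \<phi>) \<le> a"
    proof -
      have "Upow (int n + k) (evol j (int n) f) = Upow k (position j (Upow (int n) f))"
        by (simp add: evol_def Upow_add[symmetric])
      then have "cinner (Upow (int n + k) (evol j (int n) f)) \<phi> = cinner (Upow (int n) f) (position j (Upow (- k) \<phi>))"
        by (simp add: P.adjoint position_symmetric Upow_fin f \<phi>)
      then show ?thesis
        using cauchy_schwarz[of "Upow (int n) f" "position j (Upow (- k) \<phi>)"] by (simp add: a_def P.norm_preserved)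
    qed
    moreover have "cmod (cinner (Upow (int n + k) (evol j 0 f)) \<phi>) \<le> b"
      using cauchy_schwarz[of "Upow (int n + k) (evol j 0 f)" \<phi>] by (simp add: b_def P.norm_preserved evol_def)
    ultimately have "cmod (cinner (Upow (int n + k) e) \<phi>)
        + \<bar>real_of_int k\<bar> * (cmod (cinner (Upow (int n + k) (evol j (int n) f)) \<phi>) + cmod (cinner (Upow (int n + k) (evol j 0 f)) \<phi>))
        \<le> C * norm f * norm \<phi> + \<bar>real_of_int k\<bar> * (a + b)"
      by (intro add_mono mult_left_mono) auto
    moreover have "cmod (cinner (Upow (int n) (Upow k (\<Sum>i<n. evol j (int i + k) f - evol j (int i) f))) \<phi>)
        \<le> cmod (cinner (Upow (int n + k) e) \<phi>)
        + \<bar>real_of_int k\<bar> * (cmod (cinner (Upow (int n + k) (evol j (int n) f)) \<phi>) + cmod (cinner (Upow (int n + k) (evol j 0 f)) \<phi>))"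
      unfolding split cinner_add_left cinner_scaleC_left cinner_diff_left
      by (rule order_trans[OF norm_triangle_ineq])
         (simp add: norm_mult mult_left_mono norm_triangle_ineq4)
    ultimately show ?thesis by linarith
  qed
  then show ?thesis by blast
qed

section \<open>Escaping vectors and derivations of relations\<close>

text \<open>Weak convergence to 0: since norms are constant along orbits, finitely supported test
  vectors are enough.\<close>

definition escaping :: "(int ^ 'd, 'w) l2 set" where
  "escaping = {f. \<forall>\<phi>\<in>fin_supp. (\<lambda>n. cinner (Upow (int n) f) \<phi>) \<longlonglongrightarrow> 0}"

abbreviation trans_deriv :: "'d \<Rightarrow> (int \<times> (int ^ 'd) \<Rightarrow>\<^sub>0 complex) \<Rightarrow> (int \<times> (int ^ 'd) \<Rightarrow>\<^sub>0 complex)" where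
  "trans_deriv j \<equiv> weight_deriv (\<lambda>g. of_int (snd g $ j))"

text \<open>Position commutes with \<open>Op c\<close>, which is zero. Passing position through a
  group element \<open>(k, y)\<close> leaves its commutator with \<open>Upow k\<close> and a factor
  \<open>y $ j\<close> from the translation; the latter terms form \<open>trans_deriv\<close>. The
  time \<open>i\<close> is free for averaging.\<close>

lemma Op_trans_deriv:
  assumes c: "\<And>f. Op c f = 0" and f: "f \<in> fin_supp"
  shows "Op (trans_deriv j c) f = - (\<Sum>g\<in>Poly_Mapping.keys c. Poly_Mapping.lookup c g *\<^sub>C
     Upow (fst g) (evol j (i + fst g) (shift (snd g) f) - evol j i (shift (snd g) f)))"
proof -
  let ?L = "Poly_Mapping.lookup c"
  let ?K = "Poly_Mapping.keys c"
  define h where "h = Upow i f"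
  have h: "h \<in> fin_supp" by (simp add: h_def Upow_fin f)
  have 1: "Upow (- i) (position j (rep g h) - rep g (position j h))
      = Upow (fst g) (evol j (i + fst g) (shift (snd g) f) - evol j i (shift (snd g) f)) + of_int (snd g $ j) *\<^sub>C rep g f" for g
  proof -
    have a: "Upow (- i) (position j (rep g h)) = Upow (fst g) (evol j (i + fst g) (shift (snd g) f))"
      by (simp add: evol_def rep_def h_def Upow_add[symmetric] Upow_shift[symmetric] add.commute)
    have "shift (snd g) (position j h) = position j (shift (snd g) h) - of_int (snd g $ j) *\<^sub>C shift (snd g) h"
      by (simp add: position_shift h)
    then have "rep g (position j h) = Upow (fst g) (position j (Upow i (shift (snd g) f))) - of_int (snd g $ j) *\<^sub>C Upow i (rep g f)"
      by (simp add: rep_def clinearD[OF Upow_linear] h_def Upow_shift P.commute[of "fst g" i])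
    then have "Upow (- i) (rep g (position j h)) = Upow (fst g) (evol j i (shift (snd g) f)) - of_int (snd g $ j) *\<^sub>C rep g f"
      by (simp add: clinearD[OF Upow_linear] evol_def P.commute[of "fst g"] P.uminus)
    then show ?thesis using a by (simp add: clinearD[OF Upow_linear])
  qed
  have "position j (Op c h) - Op c (position j h) = 0"
    by (simp add: c position_0)
  moreover have "position j (Op c h) = (\<Sum>g\<in>?K. ?L g *\<^sub>C position j (rep g h))"
    unfolding Op_def by (subst position_sum) (simp_all add: position_scaleC rep_fin fin_supp_scaleC h)
  ultimately have "(\<Sum>g\<in>?K. ?L g *\<^sub>C (position j (rep g h) - rep g (position j h))) = 0"
    unfolding Op_def by (simp add: scaleC_diff_right sum_subtractf)
  then have "Upow (- i) (\<Sum>g\<in>?K. ?L g *\<^sub>C (position j (rep g h) - rep g (position j h))) = 0"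
    by (simp add: clinearD[OF Upow_linear])
  then have "(\<Sum>g\<in>?K. ?L g *\<^sub>C Upow (- i) (position j (rep g h) - rep g (position j h))) = 0"
    unfolding clinear_sum[OF Upow_linear] clinearD(2)[OF Upow_linear] .
  then have "(\<Sum>g\<in>?K. ?L g *\<^sub>C Upow (fst g) (evol j (i + fst g) (shift (snd g) f) - evol j i (shift (snd g) f)))
      + (\<Sum>g\<in>?K. ?L g *\<^sub>C of_int (snd g $ j) *\<^sub>C rep g f) = 0"
    unfolding 1 by (simp add: scaleC_add_right sum.distrib)
  moreover have "Op (trans_deriv j c) f = (\<Sum>g\<in>?K. ?L g *\<^sub>C of_int (snd g $ j) *\<^sub>C rep g f)"
  proof -
    have "Poly_Mapping.keys (trans_deriv j c) \<subseteq> ?K" by (auto simp: in_keys_iff lookup_weight_deriv)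
    from Op_superset[OF finite_keys this] show ?thesis
      by (simp add: lookup_weight_deriv scaleC_scaleC mult.commute)
  qed
  ultimately show ?thesis by (simp add: eq_neg_iff_add_eq_0 add.commute)
qed

text \<open>Averaging the identity \<open>U\<^sup>-\<^sup>i [X, c(U)] U\<^sup>i = 0\<close> over \<open>i < n\<close> makes the contribution of
  the commutators \<open>[X, U\<^sup>k]\<close> weakly small after applying \<open>U\<^sup>n\<close>, so only \<open>(\<partial>c)(U)\<close> survives.\<close>

lemma Op_trans_deriv_escaping:
  assumes c: "\<And>f. Op c f = 0" and f: "f \<in> fin_supp"
  shows "Op (trans_deriv j c) f \<in> escaping"
  unfolding escaping_def mem_Collect_eq
proof
  fix \<phi> :: "(int ^ 'd, 'w) l2" assume \<phi>: "\<phi> \<in> fin_supp"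
  let ?L = "Poly_Mapping.lookup c"
  let ?K = "Poly_Mapping.keys c"
  let ?s = "\<lambda>g (n::nat). \<Sum>i<n. evol j (int i + fst g) (shift (snd g) f) - evol j (int i) (shift (snd g) f)"
  have "\<exists>B. \<forall>n. cmod (cinner (Upow (int n) (Upow (fst g) (?s g n))) \<phi>) \<le> B" for g
    by (rule evol_sum_weakly_bounded[OF fin_supp_shift[OF f] \<phi>])
  then have "\<exists>B. \<forall>g n. cmod (cinner (Upow (int n) (Upow (fst g) (?s g n))) \<phi>) \<le> B g"
    by (rule choice[OF allI])
  then obtain B where B: "\<And>g n. cmod (cinner (Upow (int n) (Upow (fst g) (?s g n))) \<phi>) \<le> B g"
    by blast
  \<comment> \<open>Summing over \<open>i < n\<close> multiplies the left side by \<open>n\<close>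
    while the right side stays weakly bounded, which gives decay of order
    \<open>1 / n\<close>.\<close>
  have bound: "real n * cmod (cinner (Upow (int n) (Op (trans_deriv j c) f)) \<phi>) \<le> (\<Sum>g\<in>?K. cmod (?L g) * B g)" for n
  proof -
    have "of_nat n *\<^sub>C Op (trans_deriv j c) f = (\<Sum>i<n. Op (trans_deriv j c) f)"
      by (induction n) (simp_all add: scaleC_add_left scaleC_one)
    also have "\<dots> = (\<Sum>i<n. - (\<Sum>g\<in>?K. ?L g *\<^sub>C
     Upow (fst g) (evol j (int i + fst g) (shift (snd g) f) - evol j (int i) (shift (snd g) f))))"
      using Op_trans_deriv[OF c f] by (intro sum.cong refl) blast
    also have "\<dots> = - (\<Sum>g\<in>?K. ?L g *\<^sub>C Upow (fst g) (?s g n))"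
      unfolding sum_negf by (subst sum.swap) (simp add: clinear_sum[OF Upow_linear] scaleC_sum_right)
    finally have eq: "of_nat n * cinner (Upow (int n) (Op (trans_deriv j c) f)) \<phi>
        = - (\<Sum>g\<in>?K. ?L g * cinner (Upow (int n) (Upow (fst g) (?s g n))) \<phi>)"
      by (simp add: cinner_scaleC_left[symmetric] clinearD(2)[OF Upow_linear, symmetric])
         (simp add: clinearD[OF Upow_linear] clinear_sum[OF Upow_linear] cinner_minus_left cinner_sum_left cinner_scaleC_left)
    have "real n * cmod (cinner (Upow (int n) (Op (trans_deriv j c) f)) \<phi>)
        = cmod (of_nat n * cinner (Upow (int n) (Op (trans_deriv j c) f)) \<phi>)"
      by (simp add: norm_mult)
    also have "\<dots> = cmod (\<Sum>g\<in>?K. ?L g * cinner (Upow (int n) (Upow (fst g) (?s g n))) \<phi>)"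
      unfolding eq by (rule norm_minus_cancel)
    also have "\<dots> \<le> (\<Sum>g\<in>?K. cmod (?L g) * B g)"
      by (rule order_trans[OF norm_sum], rule sum_mono) (simp add: norm_mult B mult_left_mono)
    finally show ?thesis .
  qed
  show "(\<lambda>n. cinner (Upow (int n) (Op (trans_deriv j c) f)) \<phi>) \<longlonglongrightarrow> 0"
  proof (rule Lim_null_comparison)
    show "(\<lambda>n. (\<Sum>g\<in>?K. cmod (?L g) * B g) / real n) \<longlonglongrightarrow> 0" by (rule lim_const_over_n)
    show "eventually (\<lambda>n. cmod (cinner (Upow (int n) (Op (trans_deriv j c) f)) \<phi>) \<le> (\<Sum>g\<in>?K. cmod (?L g) * B g) / real n) sequentially"
      using eventually_gt_at_top[of 0]
    proof eventually_elim
      fix n :: nat assume "n > 0"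
      then show "cmod (cinner (Upow (int n) (Op (trans_deriv j c) f)) \<phi>) \<le> (\<Sum>g\<in>?K. cmod (?L g) * B g) / real n"
        using bound[of n] by (simp add: field_simps)
    qed
  qed
qed

text \<open>By \<open>Op_trans_deriv_escaping\<close>, \<open>f\<close> is orthogonal to the image
  of every finitely supported vector. So the adjoint kills \<open>f\<close>, and by normality the
  operator does too.\<close>

lemma Op_trans_deriv_eq_0:
  assumes c: "\<And>f. Op c f = 0" and f: "\<And>g. g \<in> escaping \<Longrightarrow> cinner g f = 0"
  shows "Op (trans_deriv j c) f = 0"
proof (rule Op_eq_0_of_star, rule eq_0_if_orthogonal_fin_supp)
  fix \<phi> :: "(int ^ 'd, 'w) l2" assume "\<phi> \<in> fin_supp"
  then have "cinner \<phi> (Op (star (trans_deriv j c)) f) = 0"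
    using f[OF Op_trans_deriv_escaping[OF c]] by (simp add: Op_star[symmetric])
  then show "cinner (Op (star (trans_deriv j c)) f) \<phi> = 0" by (subst cinner_commute) simp
qed

end

section \<open>Algebraic dependence over the group ring of translations\<close>

text \<open>Gaussian elimination: a zero equation is dropped, and otherwise a pivot
  \<open>i0\<close> removes one unknown together with one equation.\<close>

lemma underdetermined_system:
  fixes a :: "'j \<Rightarrow> 'i \<Rightarrow> 'k::field"
  assumes "finite J" "finite I" "card J < card I"
  shows "\<exists>x. (\<exists>i\<in>I. x i \<noteq> 0) \<and> (\<forall>j\<in>J. (\<Sum>i\<in>I. a j i * x i) = 0)"
  using assms
proof (induction J arbitrary: I a rule: finite_induct)
  case empty
  then obtain i where "i \<in> I" by fastforce
  then show ?case by (intro exI[of _ "\<lambda>_. 1"]) auto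
next
  case (insert j J)
  show ?case
  proof (cases "\<forall>i\<in>I. a j i = 0")
    case True
    obtain x where "\<exists>i\<in>I. x i \<noteq> 0" "\<forall>k\<in>J. (\<Sum>i\<in>I. a k i * x i) = 0"
      using insert.IH[of I a] insert.prems insert.hyps by auto
    then show ?thesis using True by (intro exI[of _ x]) auto
  next
    case False
    then obtain i0 where i0: "i0 \<in> I" "a j i0 \<noteq> 0" by blast
    define I' where "I' = I - {i0}"
    have I': "finite I'" "card J < card I'" "i0 \<notin> I'" "I = insert i0 I'"
      using insert.prems insert.hyps i0 by (auto simp: I'_def)
    obtain x where x: "\<exists>i\<in>I'. x i \<noteq> 0"
      "\<forall>k\<in>J. (\<Sum>i\<in>I'. (a k i - a k i0 * a j i / a j i0) * x i) = 0"
      using insert.IH[OF I'(1,2), of "\<lambda>k i. a k i - a k i0 * a j i / a j i0"] by blast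
    define z where "z = - (\<Sum>i\<in>I'. a j i * x i) / a j i0"
    define x' where "x' = x(i0 := z)"
    have sum: "(\<Sum>i\<in>I. a k i * x' i) = a k i0 * z + (\<Sum>i\<in>I'. a k i * x i)" for k
    proof -
      have "(\<Sum>i\<in>I'. a k i * x' i) = (\<Sum>i\<in>I'. a k i * x i)"
        using I'(3) by (intro sum.cong) (auto simp: x'_def)
      then show ?thesis using I' by (simp add: x'_def)
    qed
    have "(\<Sum>i\<in>I. a k i * x' i) = 0" if "k \<in> insert j J" for k
    proof (cases "k = j")
      case True
      then show ?thesis using i0 by (simp add: sum z_def)
    next
      case False
      have "(\<Sum>i\<in>I'. (a k i - a k i0 * a j i / a j i0) * x i)
          = (\<Sum>i\<in>I'. a k i * x i) - a k i0 / a j i0 * (\<Sum>i\<in>I'. a j i * x i)"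
        by (simp add: left_diff_distrib sum_subtractf sum_distrib_left mult.assoc)
      then show ?thesis using x(2) that False by (simp add: sum z_def)
    qed
    moreover have "\<exists>i\<in>I. x' i \<noteq> 0" using x(1) I' by (auto simp: x'_def)
    ultimately show ?thesis by blast
  qed
qed

definition cube :: "int \<Rightarrow> int \<Rightarrow> (int ^ 'd::finite) set" where
  "cube lo hi = {y. \<forall>j. lo \<le> y $ j \<and> y $ j < hi}"

lemma cube_card: "finite (cube lo hi :: (int ^ 'd::finite) set)" "card (cube lo hi :: (int ^ 'd) set) = nat (hi - lo) ^ CARD('d)"
proof -
  let ?P = "PiE (UNIV :: 'd set) (\<lambda>_. {lo..<hi})"
  have bij: "bij_betw vec_nth (cube lo hi :: (int ^ 'd) set) ?P"
    by (rule bij_betw_byWitness[of _ vec_lambda]) (auto simp: cube_def PiE_def)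
  have "finite ?P" by (intro finite_PiE) auto
  then show "finite (cube lo hi :: (int ^ 'd) set)" using bij_betw_finite[OF bij] by simp
  have "card ?P = nat (hi - lo) ^ CARD('d)" by (simp add: card_PiE)
  then show "card (cube lo hi :: (int ^ 'd) set) = nat (hi - lo) ^ CARD('d)"
    using bij_betw_same_card[OF bij] by simp
qed

text \<open>Places the group ring of translations at time exponent 0.\<close>

definition ring_embed :: "((int ^ 'd) \<Rightarrow>\<^sub>0 complex) \<Rightarrow> (int \<times> (int ^ 'd) \<Rightarrow>\<^sub>0 complex)" where
  "ring_embed a = (\<Sum>y\<in>Poly_Mapping.keys a. Poly_Mapping.single (0, y) (Poly_Mapping.lookup a y))"

lemma ring_embed_0 [simp]: "ring_embed 0 = 0"
  by (simp add: ring_embed_def)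

text \<open>Different time exponents have disjoint supports, so a polynomial in time with a nonzero
  translation coefficient is itself nonzero.\<close>

lemma lookup_ring_embed_mult_single:
  "Poly_Mapping.lookup (ring_embed a * Poly_Mapping.single (k, 0) 1) (l, y) = (if l = k then Poly_Mapping.lookup a y else 0)"
proof -
  have "ring_embed a * Poly_Mapping.single (k, 0) 1
      = (\<Sum>y\<in>Poly_Mapping.keys a. Poly_Mapping.single (k, y) (Poly_Mapping.lookup a y))"
    by (simp add: ring_embed_def sum_distrib_right mult_single)
  then show ?thesis
    by (auto simp: lookup_sum lookup_single when_def in_keys_iff cong: conj_cong)
qed

context periodic_transition
begin

lemma Op_ring_embed: "Op (ring_embed a) f = shift.Op a f"
  by (simp add: ring_embed_def Op_sum Op_single rep_def shift.Op_def)

lemma Op_shift: "Op c (shift z f) = shift z (Op c f)"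
  using Op_commute[of c "Poly_Mapping.single (0, z) 1" f] by (simp add: Op_single rep_def scaleC_one)

text \<open>Linearity and translation covariance carry the vanishing from the origin to all finitely
  supported vectors. Hence the adjoint kills every \<open>f\<close>, and normality finishes.\<close>

lemma Op_eq_0_of_spanning:
  assumes B: "\<And>x::'w. \<exists>c. x = (\<Sum>b\<in>B. c b *\<^sub>C b)"
    and 0: "\<And>b. b \<in> B \<Longrightarrow> Op c (delta 0 b) = 0"
  shows "Op c f = 0"
proof (rule Op_eq_0_of_star, rule eq_0_if_orthogonal_fin_supp)
  have 1: "Op c (delta 0 \<phi>) = 0" for \<phi>
  proof -
    obtain k where k: "\<phi> = (\<Sum>b\<in>B. k b *\<^sub>C b)" using B by blast
    have "clinear (delta 0 :: 'w \<Rightarrow> (int ^ 'd, 'w) l2)"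
      by (simp add: clinear_def delta_add delta_scaleC)
    then have "clinear (\<lambda>\<phi>. Op c (delta 0 \<phi>))" by (rule clinear_comp[OF Op_clinear])
    note lin = clinear_sum[OF this] clinearD[OF this]
    show ?thesis unfolding k by (simp only: lin) (simp add: 0)
  qed
  have 2: "Op c (delta y \<phi>) = 0" for y \<phi>
    using Op_shift[of c y "delta 0 \<phi>"] by (simp add: shift_delta 1 clinearD[OF shift.linear])
  fix \<phi> :: "(int ^ 'd, 'w) l2" assume \<phi>: "\<phi> \<in> fin_supp"
  have "Op c \<phi> = 0"
    by (subst fin_supp_expand[OF \<phi>]) (simp add: clinear_sum[OF Op_clinear] 2)
  then have "cinner \<phi> (Op (star c) f) = 0" by (simp add: Op_star[symmetric])
  then show "cinner (Op (star c) f) \<phi> = 0" by (subst cinner_commute) simp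
qed

text \<open>On a box of side \<open>L\<close> the unknown coefficients outnumber the equations when \<open>L\<close> is large
  compared with the range of the powers of \<open>c\<close>.\<close>

lemma algebraic_dependence:
  fixes c :: "int \<times> (int ^ 'd) \<Rightarrow>\<^sub>0 complex"
  obtains K and a :: "nat \<Rightarrow> (int ^ 'd) \<Rightarrow>\<^sub>0 complex"
  where "\<exists>k\<le>K. a k \<noteq> 0" "\<And>f. Op (\<Sum>k\<le>K. ring_embed (a k) * c ^ k) f = 0"
proof -
  obtain B :: "'w set" where B: "finite B" "\<And>x. \<exists>c. x = (\<Sum>b\<in>B. c b *\<^sub>C b)"
    using finite_spanning_set by blast
  \<comment> \<open>There are \<open>card B ^ 2\<close> equations per site of the enlarged box,
    which has at most \<open>2 ^ CARD('d)\<close> times as many sites as \<open>Q\<close>. The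
    \<open>K + 1\<close> powers in \<open>{..K}\<close> therefore give strictly more
    unknowns.\<close>
  define K where "K = card B ^ 2 * 2 ^ CARD('d)"
  define T where "T = (\<Union>k\<le>K. \<Union>b\<in>B. supp (Op (c ^ k) (delta 0 b)))"
  have T: "finite T" using B(1) Op_fin[OF fin_supp_delta] by (auto simp: T_def fin_supp_def)
  define r where "r = (\<Sum>y\<in>T. \<Sum>j\<in>UNIV. abs (y $ j))"
  have r0: "0 \<le> r" by (simp add: r_def sum_nonneg)
  have r: "abs (y $ j) \<le> r" if "y \<in> T" for y j
  proof -
    have "abs (y $ j) \<le> (\<Sum>j\<in>UNIV. abs (y $ j))" by (rule member_le_sum) auto
    also have "\<dots> \<le> r" unfolding r_def
      using member_le_sum[OF that, of "\<lambda>y. \<Sum>j\<in>UNIV. abs (y $ j)"] T by (simp add: sum_nonneg)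
    finally show ?thesis .
  qed
  \<comment> \<open>With this side, enlarging the box by \<open>r\<close> in both directions at most
    doubles the side.\<close>
  define L where "L = 2 * r + 1"
  define Q where "Q = (cube 0 L :: (int ^ 'd) set)"
  define Q' where "Q' = (cube (- r) (L + r) :: (int ^ 'd) set)"
  define I where "I = {..K} \<times> Q"
  define J where "J = B \<times> Q' \<times> B"
  have fin: "finite I" "finite J" "finite Q"
    using B(1) by (auto simp: I_def J_def Q_def Q'_def cube_card)
  have "card Q' \<le> (2 * nat L) ^ CARD('d)"
    unfolding Q'_def cube_card using r0 by (intro power_mono) (auto simp: L_def)
  then have "card J \<le> card B ^ 2 * (2 ^ CARD('d) * nat L ^ CARD('d))"
    by (simp add: J_def card_cartesian_product power2_eq_square power_mult_distrib)
  also have "\<dots> = K * card Q" by (simp add: K_def Q_def cube_card)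
  also have "\<dots> < Suc K * card Q" using r0 by (simp add: Q_def cube_card L_def)
  also have "\<dots> = card I" by (simp add: I_def card_cartesian_product)
  finally have "card J < card I" .
  from underdetermined_system[OF fin(2,1) this,
      of "\<lambda>(b, x, b') (k, y). cinner (l2_apply (Op (c ^ k) (delta 0 b)) (x - y)) b'"]
  obtain X where X: "\<exists>i\<in>I. X i \<noteq> 0"
    "\<forall>j\<in>J. (\<Sum>i\<in>I. (case j of (b, x, b') \<Rightarrow> \<lambda>(k, y). cinner (l2_apply (Op (c ^ k) (delta 0 b)) (x - y)) b') i * X i) = 0"
    by blast
  define a where "a k = (\<Sum>y\<in>Q. Poly_Mapping.single y (X (k, y)))" for k
  have la: "Poly_Mapping.lookup (a k) y = (if y \<in> Q then X (k, y) else 0)" for k y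
    using fin(3) by (simp add: a_def lookup_sum lookup_single when_def)
  have nz: "\<exists>k\<le>K. a k \<noteq> 0"
  proof -
    obtain k y where "k \<le> K" "y \<in> Q" "X (k, y) \<noteq> 0" using X(1) by (auto simp: I_def)
    then have "Poly_Mapping.lookup (a k) y \<noteq> 0" by (simp add: la)
    then show ?thesis using \<open>k \<le> K\<close> by (intro exI[of _ k]) auto
  qed
  define M where "M = (\<Sum>k\<le>K. ring_embed (a k) * c ^ k)"
  have OpM: "l2_apply (Op M f) x = (\<Sum>(k, y)\<in>I. X (k, y) *\<^sub>C l2_apply (Op (c ^ k) f) (x - y))" for f x
  proof -
    have "l2_apply (Op M f) x = (\<Sum>k\<le>K. l2_apply (shift.Op (a k) (Op (c ^ k) f)) x)"
      by (simp add: M_def Op_sum Op_mult Op_ring_embed l2_apply_sum)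
    also have "\<dots> = (\<Sum>k\<le>K. \<Sum>y\<in>Q. X (k, y) *\<^sub>C l2_apply (Op (c ^ k) f) (x - y))"
      by (simp add: a_def shift.Op_sum shift.Op_single l2_apply_sum shift_apply)
    finally show ?thesis by (simp add: I_def sum.cartesian_product)
  qed
  have zero: "Op M (delta 0 b) = 0" if b: "b \<in> B" for b
  proof (rule l2_eqI)
    fix x
    show "l2_apply (Op M (delta 0 b)) x = l2_apply 0 x"
    proof (cases "x \<in> Q'")
      case True
      have c0: "cinner (l2_apply (Op M (delta 0 b)) x) b' = 0" if "b' \<in> B" for b'
      proof -
        have "(b, x, b') \<in> J" using b True that by (simp add: J_def)
        with X(2) have "(\<Sum>(k, y)\<in>I. cinner (l2_apply (Op (c ^ k) (delta 0 b)) (x - y)) b' * X (k, y)) = 0"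
          by (fastforce simp: case_prod_beta)
        then show ?thesis
          unfolding OpM cinner_sum_left by (simp add: case_prod_beta cinner_scaleC_left mult.commute)
      qed
      obtain k where k: "l2_apply (Op M (delta 0 b)) x = (\<Sum>b'\<in>B. k b' *\<^sub>C b')" using B(2) by blast
      have "cinner (l2_apply (Op M (delta 0 b)) x) (\<Sum>b'\<in>B. k b' *\<^sub>C b') = 0"
        by (simp add: cinner_sum_right cinner_scaleC_right c0)
      then show ?thesis unfolding k[symmetric] by (simp add: cinner_self_eq_zero_iff)
    next
      case False
      have "l2_apply (Op (c ^ k) (delta 0 b)) (x - y) = 0" if ky: "(k, y) \<in> I" for k y
      proof (rule ccontr)
        assume "l2_apply (Op (c ^ k) (delta 0 b)) (x - y) \<noteq> 0"
        then have "x - y \<in> T" using ky b by (auto simp: T_def supp_def I_def)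
        then have *: "\<bar>x $ j - y $ j\<bar> \<le> r" for j using r[of "x - y" j] by simp
        have "0 \<le> y $ j \<and> y $ j < L" for j using ky by (simp add: I_def Q_def cube_def)
        then have "- r \<le> x $ j \<and> x $ j < L + r" for j using *[of j] by (smt (verit))
        then show False using False by (simp add: Q'_def cube_def)
      qed
      then show ?thesis unfolding OpM by (auto intro!: sum.neutral)
    qed
  qed
  show thesis
    by (rule that[OF nz]) (rule Op_eq_0_of_spanning[OF B(2) zero, unfolded M_def])
qed

text \<open>Factoring the lowest power of \<open>c\<close> out of a dependence and reducing it by
  normality leaves \<open>c * e\<close> acting as zero, with \<open>e\<close> a nonzero translation
  element plus a multiple of \<open>c\<close>. After differentiation all multiples of
  \<open>c\<close> kill \<open>f\<close>, and the translation element acts injectively.\<close>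

lemma Op_trans_deriv_closed:
  assumes f: "\<And>g. g \<in> escaping \<Longrightarrow> cinner g f = 0" and c: "Op c f = 0"
  shows "Op (trans_deriv j c) f = 0"
proof -
  obtain K and a :: "nat \<Rightarrow> (int ^ 'd) \<Rightarrow>\<^sub>0 complex"
    where a: "\<exists>k\<le>K. a k \<noteq> 0" and M: "\<And>f. Op (\<Sum>k\<le>K. ring_embed (a k) * c ^ k) f = 0"
    by (rule algebraic_dependence[of c]) (rule that)
  define i where "i = (LEAST k. a k \<noteq> 0)"
  have ai: "a i \<noteq> 0" unfolding i_def by (rule LeastI_ex) (use a in blast)
  have less: "a k = 0" if "k < i" for k using that not_less_Least unfolding i_def by blast
  have iK: "i \<le> K"
  proof -
    obtain k where "k \<le> K" "a k \<noteq> 0" using a by blast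
    then show ?thesis using less[of k] by (cases "k < i") auto
  qed
  define y where "y = (\<Sum>k\<in>{i<..K}. ring_embed (a k) * c ^ (k - Suc i))"
  define e where "e = ring_embed (a i) + c * y"
  have "(\<Sum>k\<le>K. ring_embed (a k) * c ^ k) = (\<Sum>k\<in>{i..K}. ring_embed (a k) * c ^ k)"
    by (rule sum.mono_neutral_right) (auto simp: less)
  also have "{i..K} = insert i {i<..K}" using iK by auto
  also have "(\<Sum>k\<in>insert i {i<..K}. ring_embed (a k) * c ^ k) = ring_embed (a i) * c ^ i + (\<Sum>k\<in>{i<..K}. ring_embed (a k) * c ^ k)"
    by simp
  also have "(\<Sum>k\<in>{i<..K}. ring_embed (a k) * c ^ k) = c ^ i * (c * y)"
    unfolding y_def sum_distrib_left
  proof (rule sum.cong[OF refl])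
    fix k assume "k \<in> {i<..K}"
    then have "c ^ k = c ^ i * c * c ^ (k - Suc i)"
      by (simp add: power_add[symmetric] power_Suc2[symmetric] del: power_Suc)
    then show "ring_embed (a k) * c ^ k = c ^ i * (c * (ring_embed (a k) * c ^ (k - Suc i)))" by (simp add: mult_ac)
  qed
  finally have "(\<Sum>k\<le>K. ring_embed (a k) * c ^ k) = c ^ i * e" by (simp add: e_def algebra_simps)
  then have ce: "Op (c ^ i * e) f = 0" for f using M by simp
  have "Op (c * e) f = 0" for f
  proof (cases i)
    case 0
    then show ?thesis using ce by (simp add: Op_mult clinearD[OF Op_clinear])
  next
    case (Suc n)
    show ?thesis by (rule Op_eq_0_of_power[of c n]) (use ce[of f] Suc in simp)
  qed
  from Op_trans_deriv_eq_0[OF this f] have "Op (trans_deriv j (c * e)) f = 0" by blast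
  moreover have "trans_deriv j (c * e) = ring_embed (a i) * trans_deriv j c + (trans_deriv j c * y + trans_deriv j e) * c"
  proof -
    have "trans_deriv j (c * e) = trans_deriv j c * e + c * trans_deriv j e"
      by (rule weight_deriv_mult) simp
    then show ?thesis by (simp add: e_def algebra_simps)
  qed
  ultimately have "shift.Op (a i) (Op (trans_deriv j c) f) = 0"
    by (simp add: Op_add Op_mult[of _ c] c clinearD[OF Op_clinear]) (simp add: Op_mult Op_ring_embed)
  then show ?thesis using shift_Op_injective[OF ai] by blast
qed

section \<open>Reduction to a polynomial in the transition operator\<close>

definition polyU :: "complex poly \<Rightarrow> (int ^ 'd, 'w) l2 \<Rightarrow> (int ^ 'd, 'w) l2" where
  "polyU p f = (\<Sum>i\<le>degree p. coeff p i *\<^sub>C (U ^^ i) f)"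

lemma polyU_superset: "degree p \<le> n \<Longrightarrow> polyU p f = (\<Sum>i\<le>n. coeff p i *\<^sub>C (U ^^ i) f)"
  unfolding polyU_def by (rule sum.mono_neutral_left) (auto simp: coeff_eq_0)

lemma polyU_add: "polyU (p + q) f = polyU p f + polyU q f"
proof -
  let ?n = "max (degree p) (degree q)"
  have "degree (p + q) \<le> ?n" by (rule degree_add_le_max)
  then show ?thesis
    by (simp add: polyU_superset[of _ ?n] scaleC_add_left sum.distrib)
qed

lemma polyU_0 [simp]: "polyU 0 f = 0"
  by (simp add: polyU_def)

lemma polyU_sum: "polyU (\<Sum>i\<in>I. p i) f = (\<Sum>i\<in>I. polyU (p i) f)"
  by (induction I rule: infinite_finite_induct) (simp_all add: polyU_add)

lemma polyU_monom: "polyU (monom a n) f = a *\<^sub>C (U ^^ n) f"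
  by (subst polyU_superset[OF degree_monom_le]) (simp add: if_distrib[of "\<lambda>x. x *\<^sub>C _"] cong: if_cong)

lemma polyU_pCons: "polyU (pCons a p) f = a *\<^sub>C f + polyU p (U f)"
proof -
  have "polyU (pCons a p) f = (\<Sum>i\<le>Suc (degree p). coeff (pCons a p) i *\<^sub>C (U ^^ i) f)"
    by (rule polyU_superset) (rule degree_pCons_le)
  also have "\<dots> = a *\<^sub>C f + polyU p (U f)"
    by (subst sum.atMost_Suc_shift) (simp add: polyU_def funpow_swap1)
  finally show ?thesis .
qed

lemma polyU_clinear: "clinear (polyU p)"
proof -
  have "clinear (\<lambda>f. coeff p i *\<^sub>C (U ^^ i) f)" for i
    using Upow_linear[of "int i"] by (simp add: clinear_def Upow_of_nat scaleC_add_right scaleC_scaleC mult.commute)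
  then show ?thesis
    unfolding clinear_def polyU_def by (simp add: sum.distrib scaleC_sum_right)
qed

lemma polyU_smult: "polyU (smult r p) f = r *\<^sub>C polyU p f"
  by (simp add: polyU_superset[OF degree_smult_le] scaleC_sum_right scaleC_scaleC polyU_def)

lemma polyU_linear_factor: "polyU ([:- r, 1:] * q) f = polyU q (U f - r *\<^sub>C f)"
proof -
  have "[:- r, 1:] * q = smult (- r) q + pCons 0 q" by simp
  then have "polyU ([:- r, 1:] * q) f = polyU (smult (- r) q) f + polyU (pCons 0 q) f"
    by (simp only: polyU_add)
  then show ?thesis
    unfolding polyU_smult by (simp add: polyU_pCons clinearD[OF polyU_clinear] scaleC_minus_left)
qed

text \<open>Split off a root \<open>r\<close> and apply induction to \<open>g\<close>, the image of
  \<open>f\<close> under \<open>U\<close> minus \<open>r\<close>. If \<open>r = \<omega>\<close>,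
  normality rules out a Jordan block; otherwise \<open>h\<close> solves the eigenvalue equation for
  \<open>r\<close> and must vanish.\<close>

lemma eigenvector_of_polyU:
  assumes eig: "\<And>z f. U f = z *\<^sub>C f \<Longrightarrow> f \<noteq> 0 \<Longrightarrow> z = \<omega>"
    and "p \<noteq> 0" "polyU p f = 0"
  shows "U f = \<omega> *\<^sub>C f"
  using assms(2,3)
proof (induction "degree p" arbitrary: p f)
  case 0
  then obtain a where "p = [:a:]" "a \<noteq> 0" by (metis degree_eq_zeroE pCons_0_0)
  then have "f = 0" using 0 by (simp add: polyU_pCons scaleC_eq_0_iff)
  then show ?case by (simp add: clinearD[OF U_linear])
next
  case (Suc n)
  then have "\<not> constant (poly p)" by (simp add: constant_degree)
  then obtain r where "poly p r = 0" using fundamental_theorem_of_algebra by blast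
  then obtain q where q: "p = [:- r, 1:] * q" by (auto simp: poly_eq_0_iff_dvd dvd_def)
  then have "q \<noteq> 0" using Suc.prems by auto
  then have "degree p = degree [:- r, 1:] + degree q"
    unfolding q by (intro degree_mult_eq) auto
  then have "degree p = Suc (degree q)" by simp
  define g where "g = U f - r *\<^sub>C f"
  have "polyU q g = 0" using Suc.prems(2) unfolding q polyU_linear_factor g_def .
  moreover have "n = degree q" using Suc.hyps(2) \<open>degree p = Suc (degree q)\<close> by simp
  ultimately have Ug: "U g = \<omega> *\<^sub>C g"
    using Suc.hyps(1) \<open>q \<noteq> 0\<close> by blast
  show ?case
  proof (cases "r = \<omega>")
    case True
    \<comment> \<open>The group ring element acting as \<open>U\<close> minus
      \<open>\<omega>\<close>, so that \<open>Op_eq_0_of_Op_Op\<close> applies.\<close>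
    define c :: "int \<times> (int ^ 'd) \<Rightarrow>\<^sub>0 complex"
      where "c = Poly_Mapping.single (1, 0) 1 - Poly_Mapping.single 0 \<omega>"
    have c: "Op c h = U h - \<omega> *\<^sub>C h" for h
      using Upow_of_nat[of 1 h] by (simp add: c_def Op_diff Op_single rep_def scaleC_one shift.zero)
    have "Op c (Op c f) = 0" using Ug True by (simp add: c g_def)
    then have "Op c f = 0" by (rule Op_eq_0_of_Op_Op)
    then show ?thesis by (simp add: c)
  next
    case False
    define h where "h = (\<omega> - r) *\<^sub>C f - g"
    have "U f = g + r *\<^sub>C f" by (simp add: g_def)
    then have "U h = r *\<^sub>C h"
      by (simp add: h_def clinearD[OF U_linear] Ug scaleC_diff_right scaleC_scaleC scaleC_add_right
          scaleC_diff_left algebra_simps)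
    then have "h = 0" using eig False by blast
    then have "(\<omega> - r) *\<^sub>C f = U f - r *\<^sub>C f" by (simp add: h_def g_def)
    then show ?thesis by (simp add: scaleC_diff_left)
  qed
qed

text \<open>The annihilator of \<open>f\<close> in the group ring is stable under the derivations, so an element of
  minimal support is concentrated on a single translation.\<close>

lemma eigenvector_of_orthogonal_escaping:
  assumes eig: "\<And>z f. U f = z *\<^sub>C f \<Longrightarrow> f \<noteq> 0 \<Longrightarrow> z = \<omega>"
    and f: "\<And>g. g \<in> escaping \<Longrightarrow> cinner g f = 0"
  shows "U f = \<omega> *\<^sub>C f"
proof -
  \<comment> \<open>As \<open>t\<close> acts by \<open>U\<close>, its algebraic dependence over
    translations provides a nonzero element of the annihilator of \<open>f\<close>.\<close>
  define t :: "int \<times> (int ^ 'd) \<Rightarrow>\<^sub>0 complex" where "t = Poly_Mapping.single (1, 0) 1"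
  have tk: "t ^ k = Poly_Mapping.single (int k, 0) 1" for k
  proof (induction k)
    case (Suc k)
    then show ?case by (simp add: t_def mult_single)
  qed (simp add: zero_prod_def[symmetric])
  obtain K and a :: "nat \<Rightarrow> (int ^ 'd) \<Rightarrow>\<^sub>0 complex"
    where a: "\<exists>k\<le>K. a k \<noteq> 0" and M: "\<And>f. Op (\<Sum>k\<le>K. ring_embed (a k) * t ^ k) f = 0"
    by (rule algebraic_dependence[of t]) (rule that)
  have "(\<Sum>k\<le>K. ring_embed (a k) * t ^ k) \<noteq> 0"
  proof -
    obtain k y where k: "k \<le> K" "Poly_Mapping.lookup (a k) y \<noteq> 0"
      using a by (metis poly_mapping_eqI lookup_zero)
    then have "Poly_Mapping.lookup (\<Sum>k\<le>K. ring_embed (a k) * t ^ k) (int k, y) \<noteq> 0"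
      by (simp add: lookup_sum tk lookup_ring_embed_mult_single)
    then show ?thesis by auto
  qed
  then have ex: "\<exists>m. m \<noteq> 0 \<and> Op m f = 0" using M by blast
  define m where "m = (ARG_MIN (\<lambda>m. card (Poly_Mapping.keys m)) m. m \<noteq> 0 \<and> Op m f = 0)"
  have m: "m \<noteq> 0" "Op m f = 0"
    and min: "\<And>c. c \<noteq> 0 \<Longrightarrow> Op c f = 0 \<Longrightarrow> card (Poly_Mapping.keys m) \<le> card (Poly_Mapping.keys c)"
    using arg_min_nat_lemma[of "\<lambda>m. m \<noteq> 0 \<and> Op m f = 0" _ "\<lambda>m. card (Poly_Mapping.keys m)"] ex
    unfolding m_def by blast+
  obtain k0 y0 where g0: "(k0, y0) \<in> Poly_Mapping.keys m"
    using m(1) by (metis all_not_in_conv keys_eq_empty surj_pair)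
  have same: "y = y0" if ky: "(k, y) \<in> Poly_Mapping.keys m" for k y
  proof -
    have "y $ j = y0 $ j" for j
    proof -
      \<comment> \<open>Stability under the derivation keeps \<open>c\<close> in the annihilator,
        yet its coefficient at \<open>(k0, y0)\<close> cancels, so minimality forces
        \<open>c = 0\<close>.\<close>
      define c where "c = trans_deriv j m - weight_deriv (\<lambda>_. of_int (y0 $ j)) m"
      have lc: "Poly_Mapping.lookup c g = (of_int (snd g $ j) - of_int (y0 $ j)) * Poly_Mapping.lookup m g" for g
        by (simp add: c_def lookup_minus lookup_weight_deriv algebra_simps)
      have "Op c f = 0"
        by (simp add: c_def Op_diff Op_weight_deriv_const m Op_trans_deriv_closed[OF f m(2)])
      moreover have "Poly_Mapping.keys c \<subseteq> Poly_Mapping.keys m - {(k0, y0)}"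
        by (auto simp: in_keys_iff lc)
      then have "card (Poly_Mapping.keys c) < card (Poly_Mapping.keys m)"
        using g0 by (meson card_Diff1_less card_mono finite_Diff finite_keys le_less_trans)
      ultimately have "c = 0" using min by fastforce
      then have "Poly_Mapping.lookup c (k, y) = 0" by simp
      then have "complex_of_int (y $ j) = of_int (y0 $ j)" using ky by (simp add: lc in_keys_iff)
      then show ?thesis by simp
    qed
    then show ?thesis by (simp add: vec_eq_iff)
  qed
  let ?L = "Poly_Mapping.lookup m"
  let ?K = "Poly_Mapping.keys m"
  \<comment> \<open>A common shift that makes all time exponents nonnegative.\<close>
  define N where "N = (\<Sum>g\<in>?K. \<bar>fst g\<bar>)"
  have N: "0 \<le> fst g + N" if "g \<in> ?K" for g
    using member_le_sum[OF that, of "\<lambda>g. \<bar>fst g\<bar>"] by (simp add: N_def)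
  define p where "p = (\<Sum>g\<in>?K. monom (?L g) (nat (fst g + N)))"
  \<comment> \<open>All keys of \<open>m\<close> share one translation part, so distinct keys have
    distinct exponents and nothing cancels in \<open>p\<close>.\<close>
  have "coeff p (nat (k0 + N)) = (\<Sum>g\<in>?K. if g = (k0, y0) then ?L g else 0)"
    unfolding p_def coeff_sum coeff_monom
  proof (rule sum.cong[OF refl])
    fix g assume g: "g \<in> ?K"
    have "nat (fst g + N) = nat (k0 + N) \<longleftrightarrow> g = (k0, y0)"
      using N[OF g] N[OF g0] same[of "fst g" "snd g"] g by (auto simp: prod_eq_iff)
    then show "(if nat (fst g + N) = nat (k0 + N) then ?L g else 0) = (if g = (k0, y0) then ?L g else 0)" by simp
  qed
  also have "\<dots> = ?L (k0, y0)" using g0 by simp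
  also have "\<dots> \<noteq> 0" using g0 by (simp add: in_keys_iff)
  finally have p0: "p \<noteq> 0" by auto
  have "polyU p f = (\<Sum>g\<in>?K. ?L g *\<^sub>C Upow (fst g + N) f)"
    unfolding p_def polyU_sum polyU_monom
    by (rule sum.cong[OF refl]) (simp add: N Upow_of_nat[symmetric])
  also have "\<dots> = (\<Sum>g\<in>?K. Upow N (shift (- y0) (?L g *\<^sub>C rep g f)))"
  proof (rule sum.cong[OF refl])
    fix g assume "g \<in> ?K"
    then have "snd g = y0" using same[of "fst g" "snd g"] by simp
    then show "?L g *\<^sub>C Upow (fst g + N) f = Upow N (shift (- y0) (?L g *\<^sub>C rep g f))"
      by (simp add: rep_def clinearD[OF Upow_linear] clinearD[OF shift.linear] Upow_shift[symmetric]
          shift.uminus Upow_add[symmetric] add.commute)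
  qed
  also have "\<dots> = Upow N (shift (- y0) (Op m f))"
    by (simp add: Op_def clinear_sum[OF Upow_linear] clinear_sum[OF shift.linear])
  also have "\<dots> = 0" by (simp add: m clinearD[OF Upow_linear] clinearD[OF shift.linear])
  finally have "polyU p f = 0" .
  from eigenvector_of_polyU[OF _ p0 this] show ?thesis using eig by blast
qed

section \<open>Splitting off the escaping subspace\<close>

lemma escaping_csubspace: "csubspace escaping"
  unfolding csubspace_def escaping_def
  by (auto simp: clinearD[OF Upow_linear] cinner_add_left cinner_scaleC_left
      intro!: tendsto_add_zero tendsto_mult_right_zero)

text \<open>In a complete space closedness suffices; unitarity bounds the error of replacing
  \<open>l\<close> by \<open>s m\<close> uniformly in the time \<open>n\<close>.\<close>

lemma escaping_complete: "complete escaping"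
  unfolding complete_eq_closed closed_sequential_limits
proof (intro allI impI, elim conjE)
  fix s l assume s: "\<forall>n. s n \<in> escaping" "s \<longlonglongrightarrow> l"
  show "l \<in> escaping"
    unfolding escaping_def mem_Collect_eq
  proof (intro ballI LIMSEQ_I)
    fix \<phi> :: "(int ^ 'd, 'w) l2" and r :: real assume \<phi>: "\<phi> \<in> fin_supp" and r: "0 < r"
    have "(\<lambda>m. norm (l - s m) * norm \<phi>) \<longlonglongrightarrow> 0"
      using tendsto_mult_left_zero[OF tendsto_norm_zero[OF LIM_zero[OF s(2)]], of "norm \<phi>"]
      by (simp add: norm_minus_commute)
    then have "eventually (\<lambda>m. norm (l - s m) * norm \<phi> < r / 2) sequentially"
      using r by (intro order_tendstoD(2)) auto
    then obtain m where m: "norm (l - s m) * norm \<phi> < r / 2"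
      by (auto simp: eventually_sequentially)
    have "(\<lambda>n. cinner (Upow (int n) (s m)) \<phi>) \<longlonglongrightarrow> 0"
      using s(1) \<phi> by (auto simp: escaping_def)
    then obtain M where M: "\<And>n. n \<ge> M \<Longrightarrow> cmod (cinner (Upow (int n) (s m)) \<phi>) < r / 2"
      using LIMSEQ_D[of _ "0::complex" "r / 2"] r by (metis diff_zero half_gt_zero)
    have "cmod (cinner (Upow (int n) l) \<phi> - 0) < r" if "n \<ge> M" for n
    proof -
      have "cinner (Upow (int n) l) \<phi> = cinner (Upow (int n) (l - s m)) \<phi> + cinner (Upow (int n) (s m)) \<phi>"
        by (simp add: clinearD[OF Upow_linear] cinner_diff_left)
      moreover have "cmod (cinner (Upow (int n) (l - s m)) \<phi>) \<le> norm (l - s m) * norm \<phi>"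
        using cauchy_schwarz[of "Upow (int n) (l - s m)" \<phi>] by (simp add: P.norm_preserved)
      ultimately show ?thesis
        using M[OF that] m norm_triangle_ineq[of "cinner (Upow (int n) (l - s m)) \<phi>" "cinner (Upow (int n) (s m)) \<phi>"]
        by simp
    qed
    then show "\<exists>no. \<forall>n\<ge>no. cmod (cinner (Upow (int n) l) \<phi> - 0) < r" by blast
  qed
qed

text \<open>Project \<open>g\<close> onto the escaping vectors. The rest \<open>g - p\<close> is
  orthogonal to them, so it solves the eigenvalue equation; both \<open>g\<close> and
  \<open>p\<close> are orthogonal to it, whence \<open>g = p\<close>.\<close>

lemma escaping_of_orthogonal_eigenspace:
  assumes eig: "\<And>z f. U f = z *\<^sub>C f \<Longrightarrow> f \<noteq> 0 \<Longrightarrow> z = \<omega>"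
    and g: "\<And>f. U f = \<omega> *\<^sub>C f \<Longrightarrow> cinner g f = 0"
  shows "g \<in> escaping"
proof -
  obtain p where p: "p \<in> escaping" "\<And>s. s \<in> escaping \<Longrightarrow> cinner (g - p) s = 0"
    using orthogonal_decomposition[OF escaping_csubspace escaping_complete] by blast
  have orth: "cinner s (g - p) = 0" if "s \<in> escaping" for s
    using p(2)[OF that] by (subst cinner_commute) simp
  have "U (g - p) = \<omega> *\<^sub>C (g - p)"
    using eig orth by (rule eigenvector_of_orthogonal_escaping)
  then have "cinner (g - p) (g - p) = 0"
    using g[of "g - p"] orth[OF p(1)] by (simp add: cinner_diff_left)
  then show ?thesis using p(1) by (simp add: cinner_self_eq_zero_iff)
qed

end

section \<open>Transfer to functions\<close>

text \<open>The given operator is constrained on \<open>ell2\<close> only; on the type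
  \<open>l2\<close> its laws hold for all vectors.\<close>

definition lift_op :: "(('x \<Rightarrow> 'w::complex_inner) \<Rightarrow> 'x \<Rightarrow> 'w) \<Rightarrow> ('x, 'w) l2 \<Rightarrow> ('x, 'w) l2" where
  "lift_op U f = Abs_l2 (U (l2_apply f))"

context
  fixes U :: "((int ^ 'd::finite) \<Rightarrow> 'w::fin_dim_complex_hilbert) \<Rightarrow> (int ^ 'd) \<Rightarrow> 'w"
  assumes U: "periodic_unitary_transition_operator U"
begin

lemma lift_op_apply: "l2_apply (lift_op U f) = U (l2_apply f)"
proof -
  have "U ` ell2 = ell2"
    using U by (simp add: periodic_unitary_transition_operator_def unitary_on_ell2_def)
  then have "U (l2_apply f) \<in> ell2" using l2_apply by blast
  then show ?thesis by (simp add: lift_op_def)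
qed

lemma lift_op_funpow: "l2_apply ((lift_op U ^^ n) f) = (U ^^ n) (l2_apply f)"
  by (induction n) (simp_all add: lift_op_apply)

lemma lift_op_clinear: "clinear (lift_op U)"
  unfolding clinear_def
proof (intro conjI allI)
  fix f g :: "(int ^ 'd, 'w) l2" and a :: complex
  have "l2_apply (lift_op U (f + g)) = l2_apply (lift_op U f + lift_op U g)"
    using U l2_apply[of f] l2_apply[of g]
    by (auto simp: fun_eq_iff lift_op_apply periodic_unitary_transition_operator_def unitary_on_ell2_def
        l2_apply_add[abs_def])
  then show "lift_op U (f + g) = lift_op U f + lift_op U g" by (simp only: l2_apply_inject)
  have "l2_apply (lift_op U (a *\<^sub>C f)) = l2_apply (a *\<^sub>C lift_op U f)"
    using U l2_apply[of f]
    by (auto simp: fun_eq_iff lift_op_apply periodic_unitary_transition_operator_def unitary_on_ell2_def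
        l2_apply_scaleC[abs_def])
  then show "lift_op U (a *\<^sub>C f) = a *\<^sub>C lift_op U f" by (simp only: l2_apply_inject)
qed

lemma lift_op_inner: "cinner (lift_op U f) (lift_op U g) = cinner f g"
  using U l2_apply[of f] l2_apply[of g]
  by (simp add: cinner_l2_def lift_op_apply periodic_unitary_transition_operator_def unitary_on_ell2_def)

lemma lift_op_bij: "bij (lift_op U)"
proof (rule bijI)
  show "inj (lift_op U)"
  proof (rule injI)
    fix f g assume "lift_op U f = lift_op U g"
    then have "lift_op U (f - g) = 0" by (simp add: clinearD[OF lift_op_clinear])
    then have "cinner (f - g) (f - g) = 0" by (metis lift_op_inner cinner_zero_left)
    then show "f = g" by (simp add: cinner_self_eq_zero_iff)
  qed
  show "surj (lift_op U)"
    unfolding surj_def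
  proof
    fix g :: "(int ^ 'd, 'w) l2"
    have "U ` ell2 = ell2"
      using U by (simp add: periodic_unitary_transition_operator_def unitary_on_ell2_def)
    then obtain f where f: "f \<in> ell2" "U f = l2_apply g" using l2_apply[of g] by force
    then have "l2_apply (lift_op U (Abs_l2 f)) = l2_apply g" by (simp add: lift_op_apply)
    then show "\<exists>f. g = lift_op U f" by (metis l2_apply_inject)
  qed
qed

lemma fin_supp_preserved:
  assumes lin: "clinear G" and d: "\<And>y \<phi>. G (delta y \<phi>) \<in> fin_supp" and f: "f \<in> fin_supp"
  shows "G f \<in> fin_supp"
  by (subst fin_supp_expand[OF f]) (simp add: clinear_sum[OF lin] d fin_supp_sum)

text \<open>The main point is locality of the inverse: by unitarity its matrix entries are adjoints
  of those of \<open>U\<close>, so its displacements lie in the negative of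
  \<open>S\<close>.\<close>

lemma periodic_transition_lift_op: "periodic_transition (lift_op U) (inv (lift_op U))"
proof
  let ?u = "lift_op U" and ?v = "inv (lift_op U)"
  show lin: "clinear ?u" by (rule lift_op_clinear)
  show inner: "cinner (?u f) (?u g) = cinner f g" for f g by (rule lift_op_inner)
  show uv: "?u (?v f) = f" for f using lift_op_bij by (simp add: bij_is_surj surj_f_inv_f)
  show vu: "?v (?u f) = f" for f using lift_op_bij by (simp add: bij_is_inj)
  show "?u (shift z f) = shift z (?u f)" for z f
  proof -
    have "l2_apply (shift z h) = translate z (l2_apply h)" for h :: "(int ^ 'd, 'w) l2"
      by (simp add: fun_eq_iff shift_apply translate_def)
    then have "l2_apply (?u (shift z f)) = l2_apply (shift z (?u f))"
      using U l2_apply[of f] by (simp add: lift_op_apply periodic_unitary_transition_operator_def)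
    then show ?thesis by (simp only: l2_apply_inject)
  qed
  obtain S where S: "finite S" "\<And>x y \<phi>. y \<notin> (+) x ` S \<Longrightarrow> U (delta_tensor x \<phi>) y = 0"
    using U by (auto simp: periodic_unitary_transition_operator_def)
  have local: "l2_apply (?u (delta x \<phi>)) y = 0" if "y \<notin> (+) x ` S" for x y \<phi>
    using S(2)[OF that] by (simp add: lift_op_apply delta_def delta_tensor_ell2)
  have "?u (delta x \<phi>) \<in> fin_supp" for x \<phi>
    unfolding fin_supp_def mem_Collect_eq
    by (rule finite_subset[of _ "(+) x ` S"]) (use local S(1) in \<open>auto simp: supp_def\<close>)
  then show "?u f \<in> fin_supp" if "f \<in> fin_supp" for f
    using fin_supp_preserved[OF lin] that by blast
  have "?v (f + g) = ?v (?u (?v f + ?v g))" "?v (a *\<^sub>C f) = ?v (?u (a *\<^sub>C ?v f))" for a f g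
    by (simp_all add: clinearD[OF lin] uv)
  then have vlin: "clinear ?v" by (simp add: clinear_def vu)
  have "?v (delta x \<phi>) \<in> fin_supp" for x \<phi>
    unfolding fin_supp_def mem_Collect_eq
  proof (rule finite_subset)
    show "finite ((\<lambda>s. x - s) ` S)" using S(1) by simp
    show "supp (?v (delta x \<phi>)) \<subseteq> (\<lambda>s. x - s) ` S"
    proof
      fix y assume y: "y \<in> supp (?v (delta x \<phi>))"
      show "y \<in> (\<lambda>s. x - s) ` S"
      proof (rule ccontr)
        assume no: "y \<notin> (\<lambda>s. x - s) ` S"
        have "x \<notin> (+) y ` S"
        proof
          assume "x \<in> (+) y ` S"
          then obtain s where "s \<in> S" "x = y + s" by blast
          then have "y = x - s" by simp
          then show False using no \<open>s \<in> S\<close> by blast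
        qed
        \<comment> \<open>Testing with the value at \<open>y\<close> itself moves the question to
          the image of a delta at \<open>y\<close>, where locality of \<open>U\<close>
          applies.\<close>
        define \<psi> where "\<psi> = l2_apply (?v (delta x \<phi>)) y"
        have "cinner \<psi> \<psi> = cinner (?v (delta x \<phi>)) (delta y \<psi>)"
          by (simp add: \<psi>_def cinner_delta_right)
        also have "\<dots> = cinner (delta x \<phi>) (?u (delta y \<psi>))"
          by (subst inner[symmetric]) (simp add: uv)
        also have "\<dots> = 0"
          by (simp add: cinner_delta_left local[OF \<open>x \<notin> (+) y ` S\<close>])
        finally have "\<psi> = 0" by (simp add: cinner_self_eq_zero_iff)
        then show False using y by (simp add: supp_def \<psi>_def)
      qed
    qed
  qed
  then show "?v f \<in> fin_supp" if "f \<in> fin_supp" for f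
    using fin_supp_preserved[OF vlin] that by blast
qed

lemma lift_op_eigenspace: "lift_op U f = z *\<^sub>C f \<longleftrightarrow> l2_apply f \<in> eigenspace U z"
proof -
  have "lift_op U f = z *\<^sub>C f \<longleftrightarrow> l2_apply (lift_op U f) = l2_apply (z *\<^sub>C f)"
    by (simp only: l2_apply_inject)
  also have "l2_apply (z *\<^sub>C f) = (\<lambda>x. z *\<^sub>C l2_apply f x)" by (simp add: fun_eq_iff)
  finally show ?thesis by (simp add: eigenspace_def l2_apply lift_op_apply)
qed

end

theorem corollary1p5:
  fixes U P :: "((int ^ 'd::finite) \<Rightarrow> 'w::fin_dim_complex_hilbert) \<Rightarrow> (int ^ 'd) \<Rightarrow> 'w"
    and \<omega> :: complex
    and u :: "(int ^ 'd) \<Rightarrow> 'w"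
    and x :: "int ^ 'd"
  assumes "periodic_unitary_transition_operator U"
    and "eigenvalues U = {\<omega>}"
    and "orthogonal_projection_onto (eigenspace U \<omega>) P"
    and "u \<in> ell2"
  shows "(\<lambda>n. transition_prob U n u x) \<longlonglongrightarrow> (norm (P u x))\<^sup>2"
proof -
  note U = assms(1)
  let ?T = "lift_op U"
  interpret T: periodic_transition ?T "inv ?T"
    by (rule periodic_transition_lift_op[OF U])
  have eig: "z = \<omega>" if "?T f = z *\<^sub>C f" "f \<noteq> 0" for z f
  proof -
    have "l2_apply f \<noteq> (\<lambda>x. 0)" using that(2) l2_eqI[of f 0] by (auto simp: fun_eq_iff)
    then have "z \<in> eigenvalues U"
      using that(1) unfolding lift_op_eigenspace[OF U] eigenvalues_def by blast
    then show ?thesis using assms(2) by simp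
  qed
  \<comment> \<open>An eigenvector exists since \<open>\<omega>\<close> is in
    \<open>eigenvalues U\<close>, and its norm is preserved. So the component in the eigenspace
    keeps its norm at every site.\<close>
  have \<omega>1: "cmod \<omega> = 1"
  proof -
    obtain e where e: "e \<in> eigenspace U \<omega>" "e \<noteq> (\<lambda>x. 0)"
      using assms(2) by (auto simp: eigenvalues_def)
    then have e2: "e \<in> ell2" by (simp add: eigenspace_def)
    then have "?T (Abs_l2 e) = \<omega> *\<^sub>C Abs_l2 e" using e(1) by (simp add: lift_op_eigenspace[OF U])
    moreover have "norm (?T (Abs_l2 e)) = norm (Abs_l2 e)"
      by (simp add: norm_eq_sqrt_cinner T.U_inner)
    moreover have "Abs_l2 e \<noteq> 0"
    proof
      assume "Abs_l2 e = 0"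
      then have "e = l2_apply 0" using e2 by (metis l2_apply_Abs)
      then show False using e(2) by (simp add: fun_eq_iff)
    qed
    ultimately show ?thesis by (simp add: norm_scaleC)
  qed
  have Pu: "P u \<in> eigenspace U \<omega>"
    and orth: "\<And>v. v \<in> eigenspace U \<omega> \<Longrightarrow> ell2_inner (\<lambda>x. u x - P u x) v = 0"
    using assms(3,4) by (auto simp: orthogonal_projection_onto_def)
  define q where "q = Abs_l2 (P u)"
  define g where "g = Abs_l2 u - q"
  have q: "l2_apply q = P u" using Pu by (simp add: q_def eigenspace_def)
  then have Tq: "?T q = \<omega> *\<^sub>C q" using Pu by (simp add: lift_op_eigenspace[OF U])
  have ga: "l2_apply g = (\<lambda>x. u x - P u x)"
    using assms(4) by (simp add: fun_eq_iff g_def q)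
  have "g \<in> T.escaping"
  proof (rule T.escaping_of_orthogonal_eigenspace[OF eig])
    fix f assume "?T f = \<omega> *\<^sub>C f"
    then show "cinner g f = 0" by (simp add: lift_op_eigenspace[OF U] cinner_l2_def ga orth)
  qed
  then have "\<forall>\<phi>\<in>fin_supp. (\<lambda>n. cinner ((?T ^^ n) g) \<phi>) \<longlonglongrightarrow> 0"
    by (simp add: T.escaping_def T.Upow_of_nat)
  \<comment> \<open>Deltas at \<open>x\<close> as test vectors give weak convergence of the values
    at \<open>x\<close>, which is norm convergence in the finite-dimensional
    \<open>'w\<close>.\<close>
  from bspec[OF this fin_supp_delta]
  have "(\<lambda>n. cinner (l2_apply ((?T ^^ n) g) x) \<phi>) \<longlonglongrightarrow> 0" for \<phi>
    unfolding cinner_delta_right .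
  then have lim: "(\<lambda>n. l2_apply ((?T ^^ n) g) x) \<longlonglongrightarrow> 0" by (rule tendsto_0_if_weakly)
  have pow: "(?T ^^ n) q = \<omega> ^ n *\<^sub>C q" for n
    by (induction n) (simp_all add: scaleC_one clinearD[OF T.U_linear] Tq scaleC_scaleC mult.commute)
  have split: "(U ^^ n) u x = \<omega> ^ n *\<^sub>C P u x + l2_apply ((?T ^^ n) g) x" for n
  proof -
    have "(U ^^ n) u = l2_apply ((?T ^^ n) (Abs_l2 u))"
      using assms(4) by (simp add: lift_op_funpow[OF U])
    also have "(?T ^^ n) (Abs_l2 u) = (?T ^^ n) q + (?T ^^ n) g"
      using clinearD(1)[OF T.Upow_linear[of "int n"], of q g] by (simp add: T.Upow_of_nat g_def)
    finally show ?thesis by (simp add: pow q)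
  qed
  \<comment> \<open>The phase \<open>\<omega> ^ n\<close> may oscillate, so only norms are compared,
    by the reverse triangle inequality.\<close>
  have "(\<lambda>n. norm ((U ^^ n) u x) - norm (P u x)) \<longlonglongrightarrow> 0"
  proof (rule Lim_null_comparison)
    show "(\<lambda>n. norm (l2_apply ((?T ^^ n) g) x)) \<longlonglongrightarrow> 0" by (rule tendsto_norm_zero[OF lim])
    have "norm (norm ((U ^^ n) u x) - norm (P u x)) \<le> norm (l2_apply ((?T ^^ n) g) x)" for n
      using norm_triangle_ineq3[of "(U ^^ n) u x" "\<omega> ^ n *\<^sub>C P u x"]
      by (simp add: split norm_scaleC norm_power \<omega>1)
    then show "eventually (\<lambda>n. norm (norm ((U ^^ n) u x) - norm (P u x)) \<le> norm (l2_apply ((?T ^^ n) g) x)) sequentially"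
      by simp
  qed
  then have "(\<lambda>n. norm ((U ^^ n) u x)) \<longlonglongrightarrow> norm (P u x)" by (rule LIM_zero_cancel)
  then show ?thesis unfolding transition_prob_def by (rule tendsto_power)
qed

end
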